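(* Let $n \ge 3$, let $\mathcal{A} \subseteq M_n$ be a block upper-triangular subalgebra and let $\phi : \mathcal{A} \to M_n$ be a continuous injective map (not assumed linear) which preserves commutativity and spectrum. Then $\phi$ is a Jordan embedding, and hence there exists an invertible matrix $T \in M_n$ such that either $\phi(X) = TXT^{-1}$ for all $X \in \mathcal{A}$, or $\phi(X) = TX^{t}T^{-1}$ for all $X \in \mathcal{A}$.
   Context: $M_n$ is the algebra of $n\times n$ complex matrices, $M_{p,q}$ is the space of $p\times q$ complex matrices, and $X^t$ is the transpose of $X$. A block upper-triangular subalgebra of $M_n$ is a subalgebra of $M_n$ containing all upper-triangular matrices; equivalently, it is one of the algebras $\mathcal{A}_{k_1,\ldots,k_r}$, where $r,k_1,\ldots,k_r\in\mathbb{N}$ (positive integers) satisfy $k_1+\cdots+k_r=n$ and $\mathcal{A}_{k_1,\ldots,k_r}$ consists of all matrices in $M_n$ partitioned into blocks $(X_{ij})_{1\le i,j\le r}$ with $X_{ij}\in M_{k_i,k_j}$ and $X_{ij}=0$ for $i>j$ (the case $r=1$ gives $M_n$ itself). The map $\phi$ preserves commutativity if $XY=YX$ implies $\phi(X)\phi(Y)=\phi(Y)\phi(X)$ for all $X,Y\in\mathcal{A}$; it preserves spectrum if $\sigma(\phi(X))=\sigma(X)$ for all $X\in\mathcal{A}$, where $\sigma$ denotes the set of eigenvalues. A Jordan homomorphism between complex algebras is a linear map $\phi$ such that $\phi(a\circ b)=\phi(a)\circ\phi(b)$ for all $a,b$, where $x\circ y=xy+yx$. A Jordan embedding is an injective Jordan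 homomorphism. *)

theory Defs
  imports "HOL-Analysis.Analysis"
begin

text \<open>
  The algebra of $n \times n$ complex matrices is the type \<open>complex^'n^'n\<close> with
  \<open>'n :: {finite, linorder}\<close> and $n$ = \<open>CARD('n)\<close>. The linear order on the index type plays
  the role of the usual order on $\{1, \dots, n\}$; it is what upper triangularity refers to.
\<close>

text \<open>
  The operation \<open>*s\<close> on \<open>complex^'n^'n\<close> would expect a row vector as its scalar, and \<open>*\<^sub>R\<close> only
  allows real scalars, so multiplication of a matrix by a complex scalar is introduced here.
\<close>

definition mscale :: "complex \<Rightarrow> complex^'n^'m \<Rightarrow> complex^'n^'m"  (infixr "*m" 75)
  where "c *m X = (\<chi> i j. c * X $ i $ j)"

definition upper_triangular_mat :: "complex^'n::{finite,linorder}^'n::{finite,linorder} \<Rightarrow> bool"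
  where "upper_triangular_mat X \<longleftrightarrow> (\<forall>i j. j < i \<longrightarrow> X $ i $ j = 0)"

definition mat_subalgebra :: "(complex^'n^'n) set \<Rightarrow> bool"
  where "mat_subalgebra A \<longleftrightarrow>
    0 \<in> A \<and>
    (\<forall>X\<in>A. \<forall>Y\<in>A. X + Y \<in> A) \<and>
    (\<forall>c. \<forall>X\<in>A. c *m X \<in> A) \<and>
    (\<forall>X\<in>A. \<forall>Y\<in>A. X ** Y \<in> A)"

definition block_upper_triangular_subalgebra ::
    "(complex^'n::{finite,linorder}^'n::{finite,linorder}) set \<Rightarrow> bool"
  where "block_upper_triangular_subalgebra A \<longleftrightarrow>
    mat_subalgebra A \<and> (\<forall>X. upper_triangular_mat X \<longrightarrow> X \<in> A)"

definition spectrum :: "complex^'n^'n \<Rightarrow> complex set"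
  where "spectrum X = {c. \<exists>v. v \<noteq> 0 \<and> X *v v = c *s v}"

definition preserves_commutativity_on ::
    "(complex^'n^'n) set \<Rightarrow> (complex^'n^'n \<Rightarrow> complex^'m^'m) \<Rightarrow> bool"
  where "preserves_commutativity_on A \<phi> \<longleftrightarrow>
    (\<forall>X\<in>A. \<forall>Y\<in>A. X ** Y = Y ** X \<longrightarrow> \<phi> X ** \<phi> Y = \<phi> Y ** \<phi> X)"

definition preserves_spectrum_on ::
    "(complex^'n^'n) set \<Rightarrow> (complex^'n^'n \<Rightarrow> complex^'m^'m) \<Rightarrow> bool"
  where "preserves_spectrum_on A \<phi> \<longleftrightarrow> (\<forall>X\<in>A. spectrum (\<phi> X) = spectrum X)"

definition jordan_prod :: "complex^'n^'n \<Rightarrow> complex^'n^'n \<Rightarrow> complex^'n^'n"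
  where "jordan_prod X Y = X ** Y + Y ** X"

text \<open>
  Maps defined on a subalgebra \<open>A\<close> are represented by total functions of which only the values
  on \<open>A\<close> matter. The codomain is the full matrix algebra.
\<close>

definition jordan_homomorphism_on ::
    "(complex^'n^'n) set \<Rightarrow> (complex^'n^'n \<Rightarrow> complex^'m^'m) \<Rightarrow> bool"
  where "jordan_homomorphism_on A \<phi> \<longleftrightarrow>
    (\<forall>X\<in>A. \<forall>Y\<in>A. \<phi> (X + Y) = \<phi> X + \<phi> Y) \<and>
    (\<forall>c. \<forall>X\<in>A. \<phi> (c *m X) = c *m \<phi> X) \<and>
    (\<forall>X\<in>A. \<forall>Y\<in>A. \<phi> (jordan_prod X Y) = jordan_prod (\<phi> X) (\<phi> Y))"

definition jordan_embedding_on ::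
    "(complex^'n^'n) set \<Rightarrow> (complex^'n^'n \<Rightarrow> complex^'m^'m) \<Rightarrow> bool"
  where "jordan_embedding_on A \<phi> \<longleftrightarrow> jordan_homomorphism_on A \<phi> \<and> inj_on \<phi> A"

end

theory Submission
  imports Defs "HOL-Computational_Algebra.Fundamental_Theorem_Algebra"
begin

text \<open>
  A block upper-triangular algebra consists of the matrices supported on a total preorder of the
  indices. If all matrices \<open>S D S\<^sup>-\<^sup>1\<close> with \<open>D\<close> diagonal belong to it, then \<open>\<phi>\<close> acts on them as
  \<open>S D S\<^sup>-\<^sup>1 \<mapsto> T D T\<^sup>-\<^sup>1\<close>: commutativity confines the images to one diagonalizable algebra, the spectrum
  is permuted, and by connectedness of the set of vectors with distinct entries the permutation is
  constant. Hence \<open>\<phi>\<close> maps rank-one idempotents to rank-one idempotents and preserves their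
  orthogonality, and after a similarity it fixes all diagonal matrices.

  Matrix units \<open>E\<^sub>i\<^sub>j\<close>, \<open>E\<^sub>i\<^sub>k\<close> commute, as do \<open>E\<^sub>i\<^sub>j\<close>, \<open>E\<^sub>k\<^sub>j\<close>; with injectivity and \<open>n \<ge> 3\<close> this forces all
  \<open>\<phi> E\<^sub>i\<^sub>j\<close> to be multiples of \<open>E\<^sub>i\<^sub>j\<close>, or all to be multiples of \<open>E\<^sub>j\<^sub>i\<close>; a transposition reduces to the
  first case. Then \<open>\<phi> (E\<^sub>i\<^sub>i + x E\<^sub>i\<^sub>j) = E\<^sub>i\<^sub>i + f\<^sub>i\<^sub>j(x) E\<^sub>i\<^sub>j\<close>, and orthogonality of idempotents with a single
  nonzero row to idempotents with a single nonzero column gives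
  \<open>f\<^sub>i\<^sub>j(s + x t) = f\<^sub>i\<^sub>j(s) + f\<^sub>i\<^sub>k(x) f\<^sub>k\<^sub>j(t)\<close>. So the \<open>f\<^sub>i\<^sub>j\<close> are linear, and a diagonal similarity turns
  them into the identity. Orthogonality to idempotents that are already known to be fixed then shows that every
  rank-one idempotent is fixed, and the diagonalizable matrices above are dense.
\<close>

section \<open>Rank-one and diagonal matrices\<close>

definition dotp :: "complex^'n \<Rightarrow> complex^'n \<Rightarrow> complex"
  where "dotp u v = (\<Sum>i\<in>UNIV. u $ i * v $ i)"

definition outer :: "complex^'n \<Rightarrow> complex^'n \<Rightarrow> complex^'n^'n"
  where "outer u v = (\<chi> i j. u $ i * v $ j)"

definition diagm :: "complex^'n \<Rightarrow> complex^'n^'n"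
  where "diagm d = (\<chi> i j. if i = j then d $ i else 0)"

lemma outer_nth [simp]: "outer u v $ i $ j = u $ i * v $ j"
  by (simp add: outer_def)

lemma diagm_nth [simp]: "diagm d $ i $ j = (if i = j then d $ i else 0)"
  by (simp add: diagm_def)

lemma mscale_nth [simp]: "(c *m X) $ i $ j = c * X $ i $ j"
  by (simp add: mscale_def)

lemma matrix_mult_nth: "(X ** Y) $ i $ j = (\<Sum>k\<in>UNIV. X $ i $ k * Y $ k $ j)"
  by (simp add: matrix_matrix_mult_def)

lemma axis_nth': "axis i x $ j = (if j = i then x else 0)"
  by (simp add: axis_def)

lemma dotp_commute: "dotp u v = dotp v u"
  by (simp add: dotp_def mult.commute)

lemma dotp_add_right: "dotp u (v + w) = dotp u v + dotp u w"
  by (simp add: dotp_def distrib_left sum.distrib)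

lemma dotp_diff_right: "dotp u (v - w) = dotp u v - dotp u w"
  by (simp add: dotp_def right_diff_distrib sum_subtractf)

lemma dotp_scale_right: "dotp u (c *s v) = c * dotp u v"
  by (simp add: dotp_def sum_distrib_left mult.left_commute)

lemma dotp_add_left: "dotp (v + w) u = dotp v u + dotp w u"
  by (simp add: dotp_def distrib_right sum.distrib)

lemma dotp_diff_left: "dotp (v - w) u = dotp v u - dotp w u"
  by (simp add: dotp_def left_diff_distrib sum_subtractf)

lemma dotp_scale_left: "dotp (c *s v) u = c * dotp v u"
  by (simp add: dotp_def sum_distrib_left mult.assoc)

lemma dotp_axis_left: "dotp (axis i 1) v = v $ i"
  by (simp add: dotp_def axis_nth' mult_delta_left mult_delta_right)

lemma dotp_axis_right: "dotp v (axis i 1) = v $ i"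
  by (simp add: dotp_def axis_nth' mult_delta_left mult_delta_right)

lemmas dotp_simps = dotp_add_right dotp_diff_right dotp_scale_right dotp_add_left
  dotp_diff_left dotp_scale_left dotp_axis_left dotp_axis_right

lemma dotp_zero [simp]: "dotp 0 v = 0" "dotp v 0 = 0"
  by (simp_all add: dotp_def)

lemma mscale_1 [simp]: "1 *m X = X"
  by (simp add: vec_eq_iff)

lemma mscale_0 [simp]: "0 *m X = 0" "c *m 0 = 0"
  by (simp_all add: vec_eq_iff)

lemma mscale_mscale [simp]: "a *m (b *m X) = (a * b) *m X"
  by (simp add: vec_eq_iff mult.assoc)

lemma mscale_add: "c *m (X + Y) = c *m X + c *m Y"
  by (simp add: vec_eq_iff distrib_left)

lemma mscale_mult_left: "(c *m X) ** Y = c *m (X ** Y)"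
  by (simp add: vec_eq_iff matrix_mult_nth sum_distrib_left mult.assoc)

lemma mscale_mult_right: "X ** (c *m Y) = c *m (X ** Y)"
  by (simp add: vec_eq_iff matrix_mult_nth sum_distrib_left mult.left_commute)

lemma mscale_eq_0_iff: "c *m X = 0 \<longleftrightarrow> c = 0 \<or> X = 0"
  by (auto simp: vec_eq_iff)

lemma matrix_mult_add_left: "(X + Z) ** Y = X ** Y + Z ** (Y::complex^'k^'n)" for X :: "complex^'n^'m"
  by (simp add: vec_eq_iff matrix_mult_nth sum.distrib distrib_right)

lemma matrix_mult_sum_left: "sum f K ** Y = (\<Sum>k\<in>K. f k ** (Y::complex^'n^'n))"
  by (induction K rule: infinite_finite_induct) (auto simp: matrix_mult_add_left)

lemma matrix_mult_sum_right: "Y ** sum f K = (\<Sum>k\<in>K. (Y::complex^'n^'n) ** f k)"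
  by (induction K rule: infinite_finite_induct) (auto simp: matrix_add_ldistrib)

lemma matrix_mult_diff_right: "Y ** (X - Z) = Y ** X - Y ** (Z::complex^'n^'n)" for X :: "complex^'n^'n"
  by (simp add: vec_eq_iff matrix_mult_nth sum_subtractf right_diff_distrib)

lemma outer_mult: "outer u v ** outer w z = dotp v w *m outer u z"
  by (simp add: vec_eq_iff matrix_mult_nth dotp_def sum_distrib_left sum_distrib_right ac_simps)

lemma matrix_mult_outer: "X ** outer u v = outer (X *v u) v"
  by (simp add: vec_eq_iff matrix_mult_nth matrix_vector_mult_def sum_distrib_right mult.assoc)

lemma outer_mult_matrix: "outer u v ** X = outer u (v v* X)"
  by (simp add: vec_eq_iff matrix_mult_nth vector_matrix_mult_def sum_distrib_left ac_simps)

lemma outer_scale_left: "outer (c *s u) v = c *m outer u v"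
  by (simp add: vec_eq_iff)

lemma outer_scale_right: "outer u (c *s v) = c *m outer u v"
  by (simp add: vec_eq_iff)

lemma outer_add_right: "outer u (v + w) = outer u v + outer u w"
  by (simp add: vec_eq_iff distrib_left)

lemma transpose_nth [simp]: "transpose X $ i $ j = X $ j $ i"
  by (simp add: transpose_def)

lemma transpose_outer: "transpose (outer u v) = outer v u"
  by (simp add: vec_eq_iff mult.commute)

lemma outer_eq_0_iff: "outer u v = 0 \<longleftrightarrow> u = 0 \<or> v = 0"
  by (auto simp: vec_eq_iff)

lemma transpose_diagm: "transpose (diagm d) = diagm d"
  by (simp add: vec_eq_iff)

lemma transpose_mscale: "transpose (c *m X) = c *m transpose X"
  by (simp add: vec_eq_iff)

lemma diagm_mult: "diagm d ** diagm e = diagm (\<chi> i. d $ i * e $ i)"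
  by (simp add: vec_eq_iff matrix_mult_nth mult_delta_left mult_delta_right)

lemma diagm_mult_nth: "(diagm d ** X) $ i $ j = d $ i * X $ i $ j"
  by (simp add: matrix_mult_nth mult_delta_left mult_delta_right)

lemma mult_diagm_nth: "(X ** diagm d) $ i $ j = X $ i $ j * d $ j"
  by (simp add: matrix_mult_nth mult_delta_left mult_delta_right)

lemma diagm_axis: "diagm (axis i 1) = outer (axis i 1) (axis i 1)"
  by (auto simp: vec_eq_iff axis_nth')

lemma diagm_eq_sum: "diagm d = (\<Sum>p\<in>UNIV. d $ p *m diagm (axis p 1))"
  by (auto simp: vec_eq_iff axis_nth' mult_delta_left mult_delta_right)

lemma diagm_one: "diagm (\<chi> i. c) = mat c"
  by (simp add: vec_eq_iff mat_def)

lemma matrix_vector_diagm: "diagm d *v x = (\<chi> i. d $ i * x $ i)"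
  by (simp add: vec_eq_iff matrix_vector_mult_def mult_delta_left mult_delta_right)

lemma matrix_axis: "X *v axis i 1 = (\<chi> k. X $ k $ i)"
  by (simp add: vec_eq_iff matrix_vector_mult_def axis_nth' mult_delta_left mult_delta_right)

lemma matrix_eqI_axis: "(\<And>i. X *v axis i 1 = Y *v axis i 1) \<Longrightarrow> X = Y" for X :: "complex^'n^'n"
  by (simp add: matrix_axis vec_eq_iff)

lemma sim_mult:
  fixes S :: "complex^'n^'n"
  assumes "S' ** S = mat 1"
  shows "(S ** X ** S') ** (S ** Y ** S') = S ** (X ** Y) ** S'"
  by (metis assms matrix_mul_assoc matrix_mul_rid)

lemma sim_inverse:
  fixes S :: "complex^'n^'n"
  assumes "S' ** S = mat 1"
  shows "S' ** (S ** X ** S') ** S = X"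
  by (metis assms matrix_mul_assoc matrix_mul_rid matrix_mul_lid)

lemma sim_add: "S ** (X + Y) ** S' = S ** X ** S' + S ** Y ** (S'::complex^'n^'n)"
  by (simp add: matrix_add_ldistrib matrix_mult_add_left)

lemma sim_mscale: "S ** (c *m X) ** S' = c *m (S ** X ** (S'::complex^'n^'n))"
  by (simp add: mscale_mult_left mscale_mult_right)

lemma sim_outer: "(S::complex^'n^'n) ** outer u v ** S' = outer (S *v u) (v v* S')"
  by (simp add: matrix_mult_outer outer_mult_matrix)

section \<open>Limits and continuity of matrix operations\<close>

lemma tendsto_matrixI:
  fixes f :: "'a \<Rightarrow> complex^'n^'m"
  assumes "\<And>i j. ((\<lambda>x. f x $ i $ j) \<longlongrightarrow> l $ i $ j) F"
  shows "(f \<longlongrightarrow> l) F"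
  using assms by (intro vec_tendstoI)

lemma tendsto_matrix_nth:
  "(f \<longlongrightarrow> l) F \<Longrightarrow> ((\<lambda>x. f x $ i $ j) \<longlongrightarrow> l $ i $ j) F"
  by (intro tendsto_vec_nth)

lemma tendsto_matrix_mult [tendsto_intros]:
  fixes f :: "'a \<Rightarrow> complex^'n^'n" and g :: "'a \<Rightarrow> complex^'n^'n"
  assumes "(f \<longlongrightarrow> l) F" "(g \<longlongrightarrow> m) F"
  shows "((\<lambda>x. f x ** g x) \<longlongrightarrow> l ** m) F"
  by (rule tendsto_matrixI) (auto simp: matrix_mult_nth intro!: tendsto_intros assms)

lemma tendsto_mscale [tendsto_intros]:
  fixes f :: "'a \<Rightarrow> complex^'n^'n"
  assumes "(c \<longlongrightarrow> l) F" "(f \<longlongrightarrow> m) F"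
  shows "((\<lambda>x. c x *m f x) \<longlongrightarrow> l *m m) F"
  by (rule tendsto_matrixI) (auto intro!: tendsto_intros assms)

lemma tendsto_diagm [tendsto_intros]:
  assumes "(d \<longlongrightarrow> l) F"
  shows "((\<lambda>x. diagm (d x)) \<longlongrightarrow> diagm l) F"
  by (rule tendsto_matrixI) (auto intro!: tendsto_intros assms)

lemma continuous_on_matrix_mult [continuous_intros]:
  fixes f :: "'a::topological_space \<Rightarrow> complex^'n^'n" and g :: "'a \<Rightarrow> complex^'n^'n"
  assumes "continuous_on K f" "continuous_on K g"
  shows "continuous_on K (\<lambda>x. f x ** g x)"
  using assms by (auto simp: continuous_on_def intro!: tendsto_intros)

lemma continuous_on_diagm [continuous_intros]:
  assumes "continuous_on K f"
  shows "continuous_on K (\<lambda>x. diagm (f x))"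
  using assms by (auto simp: continuous_on_def intro!: tendsto_intros)

section \<open>Spectrum and diagonalization\<close>

lemma spectrum_sim:
  fixes S :: "complex^'n^'n"
  assumes "S ** S' = mat 1" "S' ** S = mat 1"
  shows "spectrum (S ** X ** S') = spectrum X"
proof -
  have sub: "spectrum (S ** X ** S') \<subseteq> spectrum X"
    if "S ** S' = mat 1" "S' ** S = mat 1" for S S' X :: "complex^'n^'n"
  proof
    fix c assume "c \<in> spectrum (S ** X ** S')"
    then obtain v where v: "v \<noteq> 0" "S ** X ** S' *v v = c *s v" by (auto simp: spectrum_def)
    have "X *v (S' *v v) = S' *v (S ** X ** S' *v v)"
      by (metis that(2) matrix_vector_mul_assoc matrix_mul_assoc matrix_mul_lid)
    also have "\<dots> = c *s (S' *v v)" by (simp add: v vec.scale)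
    finally have "X *v (S' *v v) = c *s (S' *v v)" .
    moreover have "S' *v v \<noteq> 0"
      by (metis v(1) that(1) matrix_vector_mul_assoc matrix_vector_mul_lid matrix_vector_mult_0_right)
    ultimately show "c \<in> spectrum X" by (auto simp: spectrum_def)
  qed
  have "spectrum X = spectrum (S' ** (S ** X ** S') ** S)" by (simp add: sim_inverse assms)
  also have "\<dots> \<subseteq> spectrum (S ** X ** S')" using sub[OF assms(2,1)] .
  finally show ?thesis using sub[OF assms] by blast
qed

text \<open>An eigenvalue c is a zero of det (X - c), and determinants are invariant under
  transposition.\<close>

lemma spectrum_transpose: "spectrum (transpose X) = spectrum (X::complex^'n^'n)"
proof -
  have ex: "c \<in> spectrum X \<longleftrightarrow> \<not> invertible (X - mat c)" for c and X :: "complex^'n^'n"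
  proof -
    have "(X - mat c) *v v = X *v v - c *s v" for v
      by (simp add: vec_eq_iff matrix_vector_mult_def mat_def left_diff_distrib sum_subtractf
          mult_delta_left)
    then show ?thesis
      by (auto simp: invertible_left_inverse matrix_left_invertible_ker spectrum_def)
  qed
  have "transpose X - mat c = transpose (X - mat c)" for c
    by (auto simp: vec_eq_iff mat_def)
  then show ?thesis by (auto simp: ex invertible_det_nz)
qed

lemma spectrum_diagm: "spectrum (diagm d) = range (\<lambda>i. d $ i)"
proof safe
  fix c assume "c \<in> spectrum (diagm d)"
  then obtain v where v: "v \<noteq> 0" "diagm d *v v = c *s v" by (auto simp: spectrum_def)
  then obtain i where "v $ i \<noteq> 0" by (auto simp: vec_eq_iff)
  moreover have "d $ i * v $ i = c * v $ i"
    using arg_cong[OF v(2), of "\<lambda>x. x $ i"] by (simp add: matrix_vector_diagm)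
  ultimately have "c = d $ i" by simp
  then show "c \<in> range (\<lambda>i. d $ i)" by blast
next
  fix i
  have "diagm d *v axis i 1 = d $ i *s axis i 1"
    by (auto simp: matrix_vector_diagm vec_eq_iff axis_nth')
  moreover have "axis i (1::complex) \<noteq> 0" by simp
  ultimately show "d $ i \<in> spectrum (diagm d)"
    unfolding spectrum_def mem_Collect_eq by (intro exI[of _ "axis i 1"] conjI)
qed

lemma eigenvectors_independent:
  fixes X :: "complex^'n^'n"
  assumes "finite K" "inj_on l K" "\<And>k. k \<in> K \<Longrightarrow> w k \<noteq> 0 \<and> X *v w k = l k *s w k"
    and "(\<Sum>k\<in>K. a k *s w k) = 0" "k \<in> K"
  shows "a k = 0"
  using assms
proof (induction K arbitrary: a k rule: finite_induct)
  case empty then show ?case by simp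
next
  case (insert m K)
  have K: "\<And>k. k \<in> K \<Longrightarrow> w k \<noteq> 0 \<and> X *v w k = l k *s w k" using insert by auto
  \<comment> \<open>Applying X - \<open>l m\<close> removes the summand of \<open>w m\<close> and
    multiplies the other coefficients by nonzero factors, so the induction hypothesis applies to
    them.\<close>
  have "0 = X *v (\<Sum>k\<in>insert m K. a k *s w k) - l m *s (\<Sum>k\<in>insert m K. a k *s w k)"
    using insert.prems by simp
  also have "\<dots> = (\<Sum>k\<in>insert m K. X *v (a k *s w k)) - (\<Sum>k\<in>insert m K. l m *s (a k *s w k))"
    by (simp only: vec.sum vec.scale_sum_right)
  also have "\<dots> = (\<Sum>k\<in>insert m K. X *v (a k *s w k) - l m *s (a k *s w k))"
    by (simp only: sum_subtractf)
  also have "\<dots> = (\<Sum>k\<in>insert m K. (a k * (l k - l m)) *s w k)"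
  proof (intro sum.cong refl)
    fix k assume "k \<in> insert m K"
    then have "X *v w k = l k *s w k" using insert.prems(2) by blast
    then show "X *v (a k *s w k) - l m *s (a k *s w k) = (a k * (l k - l m)) *s w k"
      by (simp add: vec.scale vec_eq_iff algebra_simps)
  qed
  also have "\<dots> = (\<Sum>k\<in>K. (a k * (l k - l m)) *s w k)" using insert.hyps by simp
  finally have s0: "(\<Sum>k\<in>K. (a k * (l k - l m)) *s w k) = 0" by simp
  have injK: "inj_on l K" using insert.prems by (auto intro: inj_on_subset)
  have aK: "a k = 0" if "k \<in> K" for k
  proof -
    have "a k * (l k - l m) = 0"
      by (rule insert.IH[OF injK _ s0 that]) (use K in blast)
    moreover have "l k \<noteq> l m" using insert.prems(1) insert.hyps(2) that by (auto simp: inj_on_def)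
    ultimately show ?thesis by simp
  qed
  show ?case
  proof (cases "k = m")
    case True
    have "(\<Sum>k\<in>K. a k *s w k) = 0" using aK by (simp add: sum.neutral)
    then have "a m *s w m = 0" using insert.prems(3) insert.hyps by simp
    then show ?thesis using True insert.prems(2)[of m] by auto
  next
    case False then show ?thesis using aK insert.prems by auto
  qed
qed

text \<open>Eigenvectors for distinct eigenvalues are independent, so the matrix having them as
  columns is invertible.\<close>

lemma distinct_eigenvalues_diagonalizable:
  fixes X :: "complex^'n^'n"
  assumes "inj (\<lambda>i::'n. l $ i)" "\<And>i. l $ i \<in> spectrum X"
  obtains S S' where "S ** S' = mat 1" "S' ** S = mat 1" "X = S ** diagm l ** S'"
proof -
  have "\<exists>w. w \<noteq> 0 \<and> X *v w = l $ i *s w" for i using assms(2)[of i] by (auto simp: spectrum_def)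
  then obtain w where w: "\<And>i. w i \<noteq> 0 \<and> X *v w i = l $ i *s w i" by metis
  define S :: "complex^'n^'n" where "S = (\<chi> i j. w j $ i)"
  have Sx: "S *v x = (\<Sum>k\<in>UNIV. x $ k *s w k)" for x
    by (simp add: S_def vec_eq_iff matrix_vector_mult_def mult.commute)
  have "x = 0" if "S *v x = 0" for x
  proof -
    have "x $ k = 0" for k
      by (rule eigenvectors_independent[of UNIV "\<lambda>i. l $ i" w X])
        (use w assms(1) that in \<open>simp_all add: Sx\<close>)
    then show ?thesis by (simp add: vec_eq_iff)
  qed
  then obtain S' where S': "S' ** S = mat 1" using matrix_left_invertible_ker by blast
  then have S2: "S ** S' = mat 1" by (simp add: matrix_left_right_inverse)
  have "X ** S = S ** diagm l"
  proof (rule matrix_eqI_axis)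
    fix i
    have "S *v axis i 1 = w i" by (simp add: matrix_axis S_def)
    moreover have "diagm l *v axis i 1 = l $ i *s axis i 1"
      by (auto simp: matrix_vector_diagm vec_eq_iff axis_nth')
    ultimately show "X ** S *v axis i 1 = S ** diagm l *v axis i 1"
      by (metis matrix_vector_mul_assoc vec.scale w)
  qed
  then have "X = S ** diagm l ** S'" by (metis S2 matrix_mul_assoc matrix_mul_rid)
  with S' S2 that show thesis by blast
qed

lemma commute_diagm_imp_diagonal:
  assumes "inj (\<lambda>i. l $ i)" "X ** diagm l = diagm l ** X"
  shows "X = diagm (\<chi> i. X $ i $ i)"
proof -
  have "X $ i $ j = 0" if "i \<noteq> j" for i j
  proof -
    have "X $ i $ j * l $ j = l $ i * X $ i $ j"
      using assms(2) by (metis diagm_mult_nth mult_diagm_nth)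
    moreover have "l $ i \<noteq> l $ j" using assms(1) that by (auto simp: inj_def)
    ultimately show ?thesis by (simp add: mult.commute)
  qed
  then show ?thesis by (auto simp: vec_eq_iff)
qed

section \<open>Incidence algebras of total preorders\<close>

text \<open>For a block upper-triangular algebra, \<open>le i j\<close> means that the block of i
  does not come after the block of j; indices equivalent under \<open>le\<close> share a
  block.\<close>

definition incidence :: "('n \<Rightarrow> 'n \<Rightarrow> bool) \<Rightarrow> (complex^'n^'n) set"
  where "incidence le = {X. \<forall>i j. X $ i $ j \<noteq> 0 \<longrightarrow> le i j}"

text \<open>Compatibility with a linear order of the indices is left out, so that the setting is
  stable under reversing \<open>le\<close>, which is the effect of transposition. It returns in
  \<open>linear_total_preorder\<close>, where triangular form matters.\<close>

locale total_preorder =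
  fixes le :: "'n::finite \<Rightarrow> 'n \<Rightarrow> bool"
  assumes le_refl: "le i i"
    and le_trans: "le i j \<Longrightarrow> le j k \<Longrightarrow> le i k"
    and le_total: "le i j \<or> le j i"
begin

lemma incidence_mult: "X \<in> incidence le \<Longrightarrow> Y \<in> incidence le \<Longrightarrow> X ** Y \<in> incidence le"
  unfolding incidence_def mem_Collect_eq
proof (intro allI impI)
  fix i j
  assume X: "\<forall>i j. X $ i $ j \<noteq> 0 \<longrightarrow> le i j" and Y: "\<forall>i j. Y $ i $ j \<noteq> 0 \<longrightarrow> le i j"
    and "(X ** Y) $ i $ j \<noteq> 0"
  then obtain k where "X $ i $ k * Y $ k $ j \<noteq> 0"
    unfolding matrix_mult_nth by (meson sum.not_neutral_contains_not_neutral)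
  with X Y show "le i j" using le_trans by (metis mult_eq_0_iff)
qed

lemma incidence_mscale: "X \<in> incidence le \<Longrightarrow> c *m X \<in> incidence le"
  by (auto simp: incidence_def)

lemma incidence_add: "X \<in> incidence le \<Longrightarrow> Y \<in> incidence le \<Longrightarrow> X + Y \<in> incidence le"
  unfolding incidence_def by simp (metis add.right_neutral)

lemma incidence_diagm: "diagm d \<in> incidence le"
  using le_refl by (auto simp: incidence_def)

lemma incidence_zero: "0 \<in> incidence le"
  by (auto simp: incidence_def)

lemma incidence_sum: "(\<And>k. k \<in> K \<Longrightarrow> f k \<in> incidence le) \<Longrightarrow> sum f K \<in> incidence le"
  by (induction K rule: infinite_finite_induct) (auto intro: incidence_add incidence_zero)

lemma closed_incidence: "closed (incidence le)"
proof -
  have "incidence le = (\<Inter>i. \<Inter>j. if le i j then UNIV else {X. X $ i $ j = 0})"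
    by (auto simp: incidence_def)
  moreover have "closed {X::complex^'n^'n. X $ i $ j = 0}" for i j
    by (intro closed_Collect_eq continuous_intros)
  ultimately show ?thesis by (auto intro!: closed_INT)
qed

lemma outer_in_incidence: "outer u v \<in> incidence le \<longleftrightarrow> (\<forall>i j. u $ i \<noteq> 0 \<longrightarrow> v $ j \<noteq> 0 \<longrightarrow> le i j)"
  by (auto simp: incidence_def)

lemma minimal_element: "\<exists>a. \<forall>x. le a x"
proof -
  have "\<exists>a. \<forall>x\<in>K. le a x" if "finite K" for K
    using that
  proof (induction K rule: finite_induct)
    case (insert y K)
    then obtain a where "\<forall>x\<in>K. le a x" by blast
    then show ?case using le_total[of a y] le_trans le_refl by (metis insert_iff)
  qed auto
  from this[of UNIV] show ?thesis by auto
qed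

lemma incidence_row: "(\<And>k. r $ k \<noteq> 0 \<Longrightarrow> le i k) \<Longrightarrow> outer (axis i 1) r \<in> incidence le"
  by (auto simp: outer_in_incidence axis_nth')

lemma incidence_column: "(\<And>k. c $ k \<noteq> 0 \<Longrightarrow> le k j) \<Longrightarrow> outer c (axis j 1) \<in> incidence le"
  by (auto simp: outer_in_incidence axis_nth')

lemma incidence_unit: "le i j \<Longrightarrow> outer (axis i 1) (axis j 1) \<in> incidence le"
  by (auto simp: outer_in_incidence axis_nth')

end

locale incidence_map = total_preorder le
  for le :: "'n::finite \<Rightarrow> 'n \<Rightarrow> bool" +
  fixes \<phi> :: "complex^'n^'n \<Rightarrow> complex^'n^'n"
  assumes card3: "CARD('n) \<ge> 3"
    and cont: "continuous_on (incidence le) \<phi>"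
    and inj: "inj_on \<phi> (incidence le)"
    and comm: "X \<in> incidence le \<Longrightarrow> Y \<in> incidence le \<Longrightarrow> X ** Y = Y ** X \<Longrightarrow>
      \<phi> X ** \<phi> Y = \<phi> Y ** \<phi> X"
    and spec: "X \<in> incidence le \<Longrightarrow> spectrum (\<phi> X) = spectrum X"
begin

lemma third: obtains k where "k \<noteq> i" "k \<noteq> (j::'n)"
proof -
  have "card {i, j} < CARD('n)" using card3 card_insert_le_m1[of 2 "{j}" i] by (simp add: card_insert_if)
  then have "{i, j} \<noteq> UNIV" by force
  then show thesis using that by blast
qed

lemma phi_tendsto:
  assumes "\<And>m. X m \<in> incidence le" "X \<longlonglongrightarrow> Y"
  shows "(\<lambda>m. \<phi> (X m)) \<longlonglongrightarrow> \<phi> Y"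
proof -
  have "Y \<in> incidence le" using closed_incidence assms closed_sequentially by blast
  then show ?thesis using cont assms by (simp add: continuous_on_sequentially comp_def)
qed

end

section \<open>Images of diagonalizable matrices\<close>

lemma obtain_distinct_vector:
  obtains l :: "complex^'n" where "inj (\<lambda>i. l $ i)"
proof -
  obtain f :: "'n \<Rightarrow> nat" where "inj f"
    using finite_imp_inj_to_nat_seg[of "UNIV :: 'n set"] by auto
  then have "inj (\<lambda>i. (\<chi> i. (of_nat (f i) :: complex)) $ i)" by (auto simp: inj_def)
  then show thesis by (rule that)
qed

text \<open>The set of vectors with pairwise distinct entries is connected, because a line through one of
  its points meets the complement in finitely many points of the complex plane.\<close>

lemma continuous_rearrangement_eq_id:
  fixes g :: "complex^'n \<Rightarrow> complex^'n"
  assumes cont: "continuous_on UNIV g"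
    and ran: "\<And>d. range (\<lambda>i. g d $ i) \<subseteq> range (\<lambda>i. d $ i)"
    and l: "inj (\<lambda>i. l $ i)" "g l = l"
  shows "g d = d"
proof -
  define e where "e = (\<lambda>z. (1 - z) *s l + z *s d)"
  define bad where "bad = {z. \<exists>i j. i \<noteq> j \<and> e z $ i = e z $ j}"
  have e_cont: "continuous_on UNIV e"
    unfolding e_def vector_scalar_mult_def
    by (intro continuous_intros) 
  have ge_cont: "continuous_on UNIV (\<lambda>z. g (e z))"
    using continuous_on_compose2[OF cont e_cont] by auto
  have "bad \<subseteq> (\<Union>i. \<Union>j. {(l $ i - l $ j) / ((l $ i - l $ j) - (d $ i - d $ j))})"
  proof
    fix z assume "z \<in> bad"
    then obtain i j where ij: "i \<noteq> j" "e z $ i = e z $ j" by (auto simp: bad_def)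
    have "l $ i \<noteq> l $ j" using l(1) ij by (auto simp: inj_def)
    moreover have "l $ i - l $ j = z * ((l $ i - l $ j) - (d $ i - d $ j))"
      using ij(2) by (simp add: e_def algebra_simps)
    ultimately have "z = (l $ i - l $ j) / ((l $ i - l $ j) - (d $ i - d $ j))"
      by (metis eq_iff_diff_eq_0 mult_zero_right nonzero_eq_divide_eq)
    then show "z \<in> (\<Union>i. \<Union>j. {(l $ i - l $ j) / ((l $ i - l $ j) - (d $ i - d $ j))})" by blast
  qed
  then have fin: "finite bad" by (rule finite_subset) auto
  have conn: "connected (- bad)"
    using path_connected_complement_countable[of bad] fin
    by (simp add: path_connected_imp_connected countable_finite)
  have "g d $ i = d $ i" for i
  proof -
    \<comment> \<open>Off \<open>bad\<close> the entries of \<open>e z\<close> are distinct, so P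
      and Q are disjoint there. Both are closed, they cover, and 0 lies in P; connectedness then
      leaves no point for Q.\<close>
    define P where "P = {z. g (e z) $ i = e z $ i}"
    define Q where "Q = (\<Union>j\<in>-{i}. {z. g (e z) $ i = e z $ j})"
    have clP: "closed P" unfolding P_def
      by (intro closed_Collect_eq continuous_intros ge_cont e_cont)
    have clQ: "closed Q" unfolding Q_def
      by (intro closed_UN ballI closed_Collect_eq continuous_intros ge_cont e_cont) auto
    have cover: "- bad \<subseteq> P \<union> Q"
    proof
      fix z
      have "g (e z) $ i \<in> range (\<lambda>i. e z $ i)" using ran[of "e z"] by blast
      then show "z \<in> P \<union> Q" by (auto simp: P_def Q_def)
    qed
    have disj: "P \<inter> Q \<inter> - bad = {}"
    proof -
      have False if "z \<in> P" "z \<in> Q" "z \<notin> bad" for z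
        using that by (auto simp: P_def Q_def) (metis (mono_tags, lifting) bad_def mem_Collect_eq)
      then show ?thesis by blast
    qed
    have e0: "e 0 = l" by (simp add: e_def)
    have "0 \<in> P \<inter> - bad" using l by (auto simp: P_def bad_def e0 inj_def)
    then have "Q \<inter> - bad = {}"
      using conn clP clQ cover disj unfolding connected_closed by blast
    then have "- bad \<subseteq> P" using cover by blast
    \<comment> \<open>The endpoint 1 may itself be bad, since \<open>d\<close> may have equal
      entries; it is still a limit of good points because \<open>bad\<close> is finite.\<close>
    then have "closure (- bad) \<subseteq> P" using clP by (rule closure_minimal)
    moreover have "closure (- bad) = UNIV"
      using fin by (simp add: closure_complement empty_interior_finite)
    ultimately have "1 \<in> P" by blast
    then show ?thesis by (simp add: P_def e_def)
  qed
  then show ?thesis by (simp add: vec_eq_iff)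
qed

context incidence_map
begin

text \<open>T diagonalizes the image of one matrix with distinct eigenvalues \<open>l\<close>. The
  other images commute with it, so T diagonalizes them too, and their diagonals \<open>g d\<close>
  depend continuously on \<open>d\<close>, with entries among those of \<open>d\<close> and
  \<open>g l = l\<close>.\<close>

lemma image_of_diagonal_algebra:
  fixes S S' :: "complex^'n^'n"
  assumes S: "S ** S' = mat 1" "S' ** S = mat 1" and SA: "\<And>d. S ** diagm d ** S' \<in> incidence le"
  obtains T T' :: "complex^'n^'n" where "T ** T' = mat 1" "T' ** T = mat 1"
    "\<And>d. \<phi> (S ** diagm d ** S') = T ** diagm d ** T'"
proof -
  obtain l :: "complex^'n" where l: "inj (\<lambda>i. l $ i)" by (rule obtain_distinct_vector)
  define F where "F = (\<lambda>d. \<phi> (S ** diagm d ** S'))"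
  have specF: "spectrum (F d) = range (\<lambda>i. d $ i)" for d
    by (simp add: F_def spec[OF SA] spectrum_sim[OF S] spectrum_diagm)
  have commF: "F d ** F e = F e ** F d" for d e
    unfolding F_def by (intro comm SA) (simp add: sim_mult[OF S(2)] diagm_mult mult.commute)
  obtain T T' where T: "T ** T' = mat 1" "T' ** T = mat 1" "F l = T ** diagm l ** T'"
    by (rule distinct_eigenvalues_diagonalizable[of l "F l"]) (use l specF in auto)
  define G where "G = (\<lambda>d. T' ** F d ** T)"
  have Gl: "G l = diagm l" by (simp add: G_def T(3) sim_inverse[OF T(2)])
  have commG: "G d ** G e = G e ** G d" for d e
    by (simp add: G_def sim_mult[OF T(1)] commF)
  define g where "g = (\<lambda>d. \<chi> i. G d $ i $ i)"
  have Gg: "G d = diagm (g d)" for d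
    unfolding g_def by (rule commute_diagm_imp_diagonal[OF l]) (metis Gl commG)
  have contF: "continuous_on UNIV F" unfolding F_def
    by (rule continuous_on_compose2[OF cont]) (auto intro!: continuous_intros SA)
  have contG: "continuous_on UNIV G" unfolding G_def
    by (intro continuous_intros contF)
  have contg: "continuous_on UNIV g" unfolding g_def
    by (intro continuous_intros contG)
  have ran: "range (\<lambda>i. g d $ i) \<subseteq> range (\<lambda>i. d $ i)" for d
  proof -
    have "range (\<lambda>i. g d $ i) = spectrum (G d)" by (simp add: Gg spectrum_diagm)
    also have "\<dots> = range (\<lambda>i. d $ i)" by (simp add: G_def spectrum_sim[OF T(2,1)] specF)
    finally show ?thesis by simp
  qed
  have gl: "g l = l" using Gl by (simp add: g_def vec_eq_iff)
  have "g d = d" for d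
    by (rule continuous_rearrangement_eq_id[OF contg ran l gl])
  then have "F d = T ** diagm d ** T'" for d
    using sim_inverse[OF T(1), of "F d"] Gg[of d] by (simp add: G_def)
  with T that show thesis by (simp add: F_def)
qed

text \<open>An arbitrary completion of u and v to biorthogonal bases could leave the algebra. Here
  coordinate vectors are corrected only by multiples of \<open>axis i 1\<close> and of
  \<open>v\<close>, where \<open>u $ i\<close> and \<open>v $ i\<close> are nonzero.\<close>

lemma idempotent_in_diagonal_algebra:
  assumes A: "outer u v \<in> incidence le" and uv: "dotp v u = 1"
  obtains S S' :: "complex^'n^'n" and i where "S ** S' = mat 1" "S' ** S = mat 1" "\<And>d. S ** diagm d ** S' \<in> incidence le"
    "S ** diagm (axis i 1) ** S' = outer u v"
proof -
  have le: "u $ p \<noteq> 0 \<Longrightarrow> v $ q \<noteq> 0 \<Longrightarrow> le p q" for p q using A by (simp add: outer_in_incidence)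
  obtain i where i: "v $ i * u $ i \<noteq> 0"
    using uv unfolding dotp_def by (metis (no_types, lifting) sum.not_neutral_contains_not_neutral zero_neq_one)
  define s where "s p = (if p = i then u else axis p 1 - (v $ p / v $ i) *s axis i 1)" for p
  define r where "r p = (if p = i then v else axis p 1 - u $ p *s v)" for p
  have rs: "dotp (r p) (s q) = (if p = q then 1 else 0)" for p q
    using i uv by (auto simp: r_def s_def dotp_simps axis_nth')
  define S :: "complex^'n^'n" where "S = (\<chi> a b. s b $ a)"
  define S' :: "complex^'n^'n" where "S' = (\<chi> a b. r a $ b)"
  have S'S: "S' ** S = mat 1"
    using rs by (simp add: vec_eq_iff matrix_mult_nth S_def S'_def mat_def dotp_def)
  then have SS': "S ** S' = mat 1" by (simp add: matrix_left_right_inverse)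
  have col: "S *v axis p 1 = s p" for p by (simp add: matrix_axis S_def)
  have row: "axis p 1 v* S' = r p" for p
    by (simp add: vec_eq_iff vector_matrix_mult_def S'_def axis_nth' mult_delta_left mult_delta_right)
  have ax: "S ** diagm (axis p 1) ** S' = outer (s p) (r p)" for p
    by (simp add: diagm_axis sim_outer col row)
  have inA: "outer (s p) (r p) \<in> incidence le" for p
  proof (cases "p = i")
    case True then show ?thesis using A by (simp add: s_def r_def)
  next
    case False
    \<comment> \<open>Nonzero \<open>u $ i\<close> and \<open>v $ p\<close> give
      \<open>le i p\<close>; nonzero \<open>u $ p\<close> and \<open>v $ b\<close> give
      \<open>le p b\<close>; nonzero \<open>u $ i\<close> and \<open>v $ b\<close> give
      \<open>le i b\<close>.\<close>
    have "le a b" if "s p $ a \<noteq> 0" "r p $ b \<noteq> 0" for a b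
    proof -
      have a: "a = p \<or> (a = i \<and> v $ p \<noteq> 0)"
        using that(1) False by (auto simp: s_def axis_nth' split: if_splits)
      have b: "b = p \<or> (u $ p \<noteq> 0 \<and> v $ b \<noteq> 0)"
        using that(2) False by (auto simp: r_def axis_nth' split: if_splits)
      from a b i le le_refl show ?thesis by (metis mult_eq_0_iff)
    qed
    then show ?thesis by (simp add: outer_in_incidence)
  qed
  have "S ** diagm d ** S' = (\<Sum>p\<in>UNIV. d $ p *m (S ** diagm (axis p 1) ** S'))" for d
    by (subst diagm_eq_sum)
      (simp add: matrix_mult_sum_left matrix_mult_sum_right mscale_mult_left mscale_mult_right)
  then have "S ** diagm d ** S' \<in> incidence le" for d
    using inA by (auto simp: ax intro!: incidence_sum incidence_mscale)
  moreover have "S ** diagm (axis i 1) ** S' = outer u v"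
    by (simp add: ax) (simp add: s_def r_def)
  ultimately show thesis using that SS' S'S by blast
qed

text \<open>The same factors serve for all scalars c, because one T describes the images of the
  whole diagonal algebra. Limits of multiples of idempotents rely on this.\<close>

lemma rank_one_idempotent_image:
  assumes "outer u v \<in> incidence le" "dotp v u = 1"
  obtains u' v' where "dotp v' u' = 1" "\<And>c. \<phi> (c *m outer u v) = c *m outer u' v'"
proof -
  obtain S S' :: "complex^'n^'n" and i where S: "S ** S' = mat 1" "S' ** S = mat 1" "\<And>d. S ** diagm d ** S' \<in> incidence le"
    "S ** diagm (axis i 1) ** S' = outer u v"
    using idempotent_in_diagonal_algebra[OF assms] by blast
  obtain T T' :: "complex^'n^'n" where T: "T ** T' = mat 1" "T' ** T = mat 1"
    "\<And>d. \<phi> (S ** diagm d ** S') = T ** diagm d ** T'"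
    using image_of_diagonal_algebra[OF S(1,2,3)] by blast
  define u' where "u' = T *v axis i 1"
  define v' where "v' = axis i 1 v* T'"
  have "outer u' v' = T ** diagm (axis i 1) ** T'"
    by (simp add: diagm_axis sim_outer u'_def v'_def)
  have ci: "diagm (c *s axis i 1) = c *m diagm (axis i 1)" for c
    by (auto simp: vec_eq_iff)
  have "\<phi> (c *m outer u v) = c *m outer u' v'" for c
    using T(3)[of "c *s axis i 1"] S(4)
    by (simp add: ci sim_mscale \<open>outer u' v' = _\<close>)
  moreover have "dotp v' u' = (T' ** T) $ i $ i"
    by (simp add: u'_def v'_def matrix_axis vector_matrix_mult_def dotp_def matrix_mult_nth axis_nth'
        mult_delta_left mult_delta_right)
  then have "dotp v' u' = 1" by (simp add: T(2) mat_def)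
  ultimately show thesis using that by blast
qed

text \<open>Two commuting rank-one idempotents are equal or orthogonal.\<close>

lemma orthogonal_image:
  assumes A: "outer u v \<in> incidence le" "dotp v u = 1" "outer w z \<in> incidence le" "dotp z w = 1"
    and ort: "dotp v w = 0" "dotp z u = 0"
    and img: "\<phi> (outer u v) = outer u' v'" "\<phi> (outer w z) = outer w' z'"
    and img1: "dotp v' u' = 1" "dotp z' w' = 1"
  shows "dotp v' w' = 0" "dotp z' u' = 0"
proof -
  let ?P = "outer u' v'" and ?Q = "outer w' z'"
  have "outer u v ** outer w z = outer w z ** outer u v"
    using ort by (simp add: outer_mult)
  then have c: "?P ** ?Q = ?Q ** ?P" using comm[OF A(1,3)] img by simp
  then have c': "dotp v' w' *m outer u' z' = dotp z' u' *m outer w' v'"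
    by (simp add: outer_mult)
  have "outer u v \<noteq> outer w z"
  proof
    assume "outer u v = outer w z"
    then have "outer u v ** outer u v = outer u v ** outer w z" by simp
    then have "outer u v = 0" using A ort by (simp add: outer_mult)
    then show False using A by (auto simp: outer_eq_0_iff)
  qed
  then have PQ: "?P \<noteq> ?Q" using inj A img by (metis inj_on_def)
  have c2: "(dotp v' w' * dotp z' u') *m ?P = ?P ** ?Q ** ?P"
    by (simp add: outer_mult mscale_mult_left mult.commute)
  have c3: "(dotp v' w' * dotp z' u') *m ?Q = ?Q ** ?P ** ?Q"
    by (simp add: outer_mult mscale_mult_left mult.commute)
  have PP: "?P ** ?P = ?P" "?Q ** ?Q = ?Q" using img1 by (simp_all add: outer_mult)
  have e1: "?P ** ?Q ** ?P = ?P ** ?Q" by (metis c PP matrix_mul_assoc)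
  have e2: "?Q ** ?P ** ?Q = ?P ** ?Q" by (metis c PP matrix_mul_assoc)
  \<comment> \<open>For commuting idempotents PQP = PQ = QPQ. The outer terms are tP and tQ, and P
    differs from Q by injectivity, so t = 0.\<close>
  define t where "t = dotp v' w' * dotp z' u'"
  have "t *m ?P = t *m ?Q" using c2 c3 e1 e2 by (simp add: t_def)
  then have t0: "t = 0"
    using PQ by (auto simp: vec_eq_iff)
  then have PQ0: "?P ** ?Q = 0" using c2 unfolding e1 t_def[symmetric] by simp
  then have QP0: "?Q ** ?P = 0" using c by simp
  have nz: "u' \<noteq> 0" "v' \<noteq> 0" "w' \<noteq> 0" "z' \<noteq> 0" using img1 by auto
  show "dotp v' w' = 0" using PQ0 nz by (auto simp: outer_mult mscale_eq_0_iff outer_eq_0_iff)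
  show "dotp z' u' = 0" using QP0 nz by (auto simp: outer_mult mscale_eq_0_iff outer_eq_0_iff)
qed

text \<open>Transposition reverses the preorder, so that statements about rows yield statements about
  columns.\<close>

lemma dual: "incidence_map (\<lambda>i j. le j i) (\<lambda>X. transpose (\<phi> (transpose X)))"
proof
  have tA: "X \<in> incidence (\<lambda>i j. le j i) \<longleftrightarrow> transpose X \<in> incidence le" for X
    by (auto simp: incidence_def)
  have ct: "continuous_on K transpose" for K :: "(complex^'n^'n) set"
    unfolding transpose_def by (intro continuous_intros)
  show "le i i" for i by (rule le_refl)
  show "le j i \<Longrightarrow> le k j \<Longrightarrow> le k i" for i j k using le_trans by blast
  show "le j i \<or> le i j" for i j using le_total by blast
  show "CARD('n) \<ge> 3" by (rule card3)
  show "continuous_on (incidence (\<lambda>i j. le j i)) (\<lambda>X. transpose (\<phi> (transpose X)))"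
    by (rule continuous_on_compose2[OF ct continuous_on_compose2[OF cont ct]]) (auto simp: tA)
  show "inj_on (\<lambda>X. transpose (\<phi> (transpose X))) (incidence (\<lambda>i j. le j i))"
    by (rule inj_onI) (use inj_onD[OF inj] tA in \<open>auto dest!: inj_onD[OF inj]\<close>)
  show "transpose (\<phi> (transpose X)) ** transpose (\<phi> (transpose Y)) =
      transpose (\<phi> (transpose Y)) ** transpose (\<phi> (transpose X))"
    if "X \<in> incidence (\<lambda>i j. le j i)" "Y \<in> incidence (\<lambda>i j. le j i)" "X ** Y = Y ** X" for X Y
    using comm[of "transpose Y" "transpose X"] that by (metis matrix_transpose_mul tA)
  show "spectrum (transpose (\<phi> (transpose X))) = spectrum X"
    if "X \<in> incidence (\<lambda>i j. le j i)" for X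
    using spec[of "transpose X"] that by (simp add: spectrum_transpose tA)
qed

lemma post_transpose: "incidence_map le (\<lambda>X. transpose (\<phi> X))"
proof
  have ct: "continuous_on K transpose" for K :: "(complex^'n^'n) set"
    unfolding transpose_def by (intro continuous_intros)
  show "continuous_on (incidence le) (\<lambda>X. transpose (\<phi> X))"
    by (rule continuous_on_compose2[OF ct cont]) auto
  show "inj_on (\<lambda>X. transpose (\<phi> X)) (incidence le)"
    by (rule inj_onI) (auto dest!: inj_onD[OF inj])
  show "transpose (\<phi> X) ** transpose (\<phi> Y) = transpose (\<phi> Y) ** transpose (\<phi> X)"
    if "X \<in> incidence le" "Y \<in> incidence le" "X ** Y = Y ** X" for X Y
    using comm[of Y X] that by (metis matrix_transpose_mul)
  show "spectrum (transpose (\<phi> X)) = spectrum X" if "X \<in> incidence le" for X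
    using spec[of X] that by (simp add: spectrum_transpose)
qed (use le_refl le_trans le_total card3 in blast)+

lemma post_similarity:
  assumes M: "M ** M' = mat 1" "M' ** M = mat 1"
  shows "incidence_map le (\<lambda>X. M ** \<phi> X ** M')"
proof
  show "continuous_on (incidence le) (\<lambda>X. M ** \<phi> X ** M')"
    by (intro continuous_intros cont)
  show "inj_on (\<lambda>X. M ** \<phi> X ** M') (incidence le)"
    using inj unfolding inj_on_def by (metis sim_inverse[OF M(2)])
  show "(M ** \<phi> X ** M') ** (M ** \<phi> Y ** M') = (M ** \<phi> Y ** M') ** (M ** \<phi> X ** M')"
    if "X \<in> incidence le" "Y \<in> incidence le" "X ** Y = Y ** X" for X Y
    using comm[of X Y] that by (simp add: sim_mult[OF M(2)])
  show "spectrum (M ** \<phi> X ** M') = spectrum X" if "X \<in> incidence le" for X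
    using spec[of X] that by (simp add: spectrum_sim[OF M])
qed (use le_refl le_trans le_total card3 in blast)+

end

section \<open>Correspondence between the factors of rank-one idempotents\<close>

abbreviation ax :: "'n \<Rightarrow> complex^'n"
  where "ax i \<equiv> axis i 1"

context incidence_map
begin

text \<open>A relation rather than a function, since \<open>u'\<close> and \<open>v'\<close> are
  determined only up to reciprocal scalars.\<close>

definition img :: "complex^'n \<Rightarrow> complex^'n \<Rightarrow> complex^'n \<Rightarrow> complex^'n \<Rightarrow> bool"
  where "img u v u' v' \<longleftrightarrow> outer u v \<in> incidence le \<and> dotp v u = 1 \<and>
    \<phi> (outer u v) = outer u' v' \<and> dotp v' u' = 1"

lemma img_ex:
  assumes "outer u v \<in> incidence le" "dotp v u = 1"
  obtains u' v' where "img u v u' v'"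
  using rank_one_idempotent_image[OF assms] assms unfolding img_def by (metis mscale_1)

lemma img_scale: "img u v u' v' \<Longrightarrow> \<phi> (c *m outer u v) = c *m outer u' v'"
  unfolding img_def using rank_one_idempotent_image[of u v] by (metis mscale_1)

lemma img_orthogonal:
  assumes "img u v u' v'" "img w z w' z'" "dotp v w = 0" "dotp z u = 0"
  shows "dotp v' w' = 0" "dotp z' u' = 0"
  using orthogonal_image[of u v w z u' v' w' z'] assms unfolding img_def by auto

lemma img_cong: "img u v u' v' \<Longrightarrow> outer u' v' = outer u'' v'' \<Longrightarrow> dotp v'' u'' = 1 \<Longrightarrow> img u v u'' v''"
  by (simp add: img_def)

lemma phi_zero: "\<phi> 0 = 0"
proof -
  have "outer (ax i) (ax i) \<in> incidence le" for i
    using incidence_diagm[of "ax i"] by (simp add: diagm_axis)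
  moreover have "dotp (ax i) (ax i) = 1" for i :: 'n by (simp add: dotp_simps)
  ultimately obtain u' v' where "img (ax undefined) (ax undefined) u' v'" by (rule img_ex)
  from img_scale[OF this, of 0] show ?thesis by simp
qed

end

section \<open>Images of matrix units\<close>

text \<open>The index sets {i, j} and {i, k} meet only in i, so in either product only the summand
  with inner index i survives.\<close>

lemma matrix_unit_commute_entries:
  fixes N M :: "complex^'n^'n"
  assumes "i \<noteq> j" "i \<noteq> k" "j \<noteq> k"
    and N: "\<And>a b. N $ a $ b \<noteq> 0 \<Longrightarrow> a \<in> {i, j} \<and> b \<in> {i, j}"
    and M: "\<And>a b. M $ a $ b \<noteq> 0 \<Longrightarrow> a \<in> {i, k} \<and> b \<in> {i, k}"
    and c: "N ** M = M ** N"
  shows "N $ r $ i * M $ i $ s = M $ r $ i * N $ i $ s"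
proof -
  have "(N ** M) $ r $ s = N $ r $ i * M $ i $ s"
  proof -
    have "N $ r $ t * M $ t $ s = 0" if "t \<noteq> i" for t
      using that assms(1-3) N[of r t] M[of t s] by auto
    then show ?thesis unfolding matrix_mult_nth
      by (subst sum.remove[of _ i]) (auto simp: sum.neutral)
  qed
  moreover have "(M ** N) $ r $ s = M $ r $ i * N $ i $ s"
  proof -
    have "M $ r $ t * N $ t $ s = 0" if "t \<noteq> i" for t
      using that assms(1-3) M[of r t] N[of t s] by auto
    then show ?thesis unfolding matrix_mult_nth
      by (subst sum.remove[of _ i]) (auto simp: sum.neutral)
  qed
  ultimately show ?thesis using c by simp
qed

lemma matrix_with_single_entry:
  assumes "\<And>a b. (a, b) \<noteq> (i, j) \<Longrightarrow> X $ a $ b = 0"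
  shows "X = X $ i $ j *m outer (axis i 1) (axis j 1)"
  using assms by (auto simp: vec_eq_iff axis_nth')

locale diagonal_fixing_map = incidence_map le \<phi>
  for le :: "'n::finite \<Rightarrow> 'n \<Rightarrow> bool" and \<phi> :: "complex^'n^'n \<Rightarrow> complex^'n^'n" +
  assumes diag: "\<phi> (diagm d) = diagm d"
begin

lemma dual_diagonal_fixing:
  "diagonal_fixing_map (\<lambda>i j. le j i) (\<lambda>X. transpose (\<phi> (transpose X)))"
  using dual by (simp add: diagonal_fixing_map_def diagonal_fixing_map_axioms_def
      transpose_diagm diag)

lemma post_transpose_diagonal_fixing:
  "diagonal_fixing_map le (\<lambda>X. transpose (\<phi> X))"
  using post_transpose by (simp add: diagonal_fixing_map_def diagonal_fixing_map_axioms_def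
      transpose_diagm diag)

lemma img_axis: "img (ax k) (ax k) (ax k) (ax k)"
  using diag[of "ax k"] incidence_diagm[of "ax k"] by (simp add: img_def diagm_axis dotp_simps)

text \<open>The idempotent \<open>outer (ax k) (ax k)\<close> is fixed, and it is orthogonal to
  \<open>outer u v\<close>.\<close>

lemma img_support:
  assumes "img u v u' v'" "u $ k = 0" "v $ k = 0"
  shows "u' $ k = 0" "v' $ k = 0"
  using img_orthogonal[OF assms(1) img_axis[of k]] assms(2,3) by (auto simp: dotp_simps)

lemma img_row_ex:
  assumes "r $ i = 1" "\<And>k. r $ k \<noteq> 0 \<Longrightarrow> le i k"
  obtains u' v' where "img (ax i) r u' v'"
  using img_ex[OF incidence_row[OF assms(2)]] assms(1) by (auto simp: dotp_simps)

text \<open>\<open>E\<^sub>i\<^sub>j\<close> is the limit of \<open>t (E\<^sub>i\<^sub>i + t\<^sup>-\<^sup>1 E\<^sub>i\<^sub>j)\<close>, a multiple of a rank-one idempotent, as \<open>t\<close> tends to 0.\<close>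

lemma unit_image:
  assumes ij: "le i j" "i \<noteq> j"
  defines "N \<equiv> \<phi> (outer (ax i) (ax j))"
  shows "N \<noteq> 0" "\<And>a b. N $ a $ b \<noteq> 0 \<Longrightarrow> a \<in> {i, j} \<and> b \<in> {i, j}"
    "N $ i $ i + N $ j $ j = 0" "N $ i $ i * N $ i $ i + N $ i $ j * N $ j $ i = 0"
proof -
  have "outer (ax i) (ax j) \<noteq> (0::complex^'n^'n)" by (simp add: outer_eq_0_iff)
  then show "N \<noteq> 0" using inj incidence_unit[OF ij(1)] incidence_zero phi_zero
    unfolding N_def by (metis inj_on_def)
  define r where "r m = ax i + of_nat (Suc m) *s ax j" for m
  have "\<exists>u v. img (ax i) (r m) u v" for m
  proof -
    have "r m $ i = 1" using ij by (simp add: r_def axis_nth')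
    moreover have "le i k" if "r m $ k \<noteq> 0" for k
      using that ij le_refl by (auto simp: r_def axis_nth' split: if_splits)
    ultimately show ?thesis by (metis img_row_ex)
  qed
  then obtain u v where uv: "\<And>m. img (ax i) (r m) (u m) (v m)" by metis
  define t where "t m = (1 / of_nat (Suc m) :: complex)" for m
  have t0: "t \<longlonglongrightarrow> 0" unfolding t_def
    by (rule LIMSEQ_Suc[of "\<lambda>m. 1 / of_nat m"]) (rule lim_1_over_n)
  define X where "X m = t m *m outer (ax i) (r m)" for m
  define F where "F m = t m *m outer (u m) (v m)" for m
  have XF: "\<phi> (X m) = F m" for m using img_scale[OF uv] by (simp add: X_def F_def)
  have XA: "X m \<in> incidence le" for m
    using uv[of m] unfolding X_def img_def by (intro incidence_mscale) simp
  have tm: "t m * of_nat (Suc m) = 1" for m by (simp add: t_def del: of_nat_Suc)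
  have "X = (\<lambda>m. t m *m outer (ax i) (ax i) + outer (ax i) (ax j))"
    using tm by (simp add: fun_eq_iff X_def r_def outer_add_right outer_scale_right mscale_add del: of_nat_Suc)
  moreover have "(\<lambda>m. t m *m outer (ax i) (ax i) + outer (ax i) (ax j)) \<longlonglongrightarrow>
      0 *m outer (ax i) (ax i) + outer (ax i) (ax j)"
    by (intro tendsto_intros t0)
  ultimately have "X \<longlonglongrightarrow> outer (ax i) (ax j)" by simp
  then have FN: "F \<longlonglongrightarrow> N" using phi_tendsto[OF XA] by (simp add: XF N_def)
  have zero: "N $ a $ b = 0" if "a \<notin> {i, j} \<or> b \<notin> {i, j}" for a b
  proof -
    have "F m $ a $ b = 0" for m
    proof -
      have "u m $ k = 0 \<and> v m $ k = 0" if "k \<notin> {i, j}" for k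
        using img_support[OF uv[of m], of k] that by (auto simp: r_def axis_nth')
      with that show ?thesis by (auto simp: F_def)
    qed
    then have "(\<lambda>m. F m $ a $ b) \<longlonglongrightarrow> 0" by simp
    with tendsto_matrix_nth[OF FN] show ?thesis using LIMSEQ_unique by blast
  qed
  then show "\<And>a b. N $ a $ b \<noteq> 0 \<Longrightarrow> a \<in> {i, j} \<and> b \<in> {i, j}" by blast
  have two: "sum h UNIV = h i + h j" if "\<And>k. k \<notin> {i, j} \<Longrightarrow> h k = 0" for h :: "'n \<Rightarrow> complex"
  proof -
    have "sum h UNIV = sum h {i, j}" by (rule sum.mono_neutral_right) (use that in auto)
    then show ?thesis using ij by simp
  qed
  \<comment> \<open>\<open>F m\<close> has trace \<open>t m\<close> and square
    \<open>t m *m F m\<close>; in the limit, N has trace 0 and square 0.\<close>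
  have "(\<Sum>a\<in>UNIV. F m $ a $ a) = t m" for m
    using uv[of m] by (simp add: F_def img_def dotp_def flip: sum_distrib_left) (simp add: mult.commute)
  moreover have "(\<lambda>m. \<Sum>a\<in>UNIV. F m $ a $ a) \<longlonglongrightarrow> (\<Sum>a\<in>UNIV. N $ a $ a)"
    by (intro tendsto_sum tendsto_matrix_nth FN)
  ultimately have "(\<Sum>a\<in>UNIV. N $ a $ a) = 0" using t0 LIMSEQ_unique by auto
  then show "N $ i $ i + N $ j $ j = 0" using two[of "\<lambda>a. N $ a $ a"] zero by auto
  have "F m ** F m = t m *m F m" for m
    using uv[of m] by (simp add: F_def img_def mscale_mult_left mscale_mult_right outer_mult)
  moreover have "(\<lambda>m. F m ** F m) \<longlonglongrightarrow> N ** N" by (intro tendsto_intros FN)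
  moreover have "(\<lambda>m. t m *m F m) \<longlonglongrightarrow> 0 *m N" by (intro tendsto_intros FN t0)
  ultimately have "N ** N = 0" using LIMSEQ_unique by auto
  then have "(N ** N) $ i $ i = 0" by simp
  then show "N $ i $ i * N $ i $ i + N $ i $ j * N $ j $ i = 0"
    unfolding matrix_mult_nth using two[of "\<lambda>k. N $ i $ k * N $ k $ i"] zero by auto
qed

definition up where "up i j \<longleftrightarrow> (\<exists>c. c \<noteq> 0 \<and> \<phi> (outer (ax i) (ax j)) = c *m outer (ax i) (ax j))"
definition dn where "dn i j \<longleftrightarrow> (\<exists>c. c \<noteq> 0 \<and> \<phi> (outer (ax i) (ax j)) = c *m outer (ax j) (ax i))"

lemma up_dn_exclusive: "i \<noteq> j \<Longrightarrow> up i j \<Longrightarrow> dn i j \<Longrightarrow> False"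
proof -
  assume "i \<noteq> j" "up i j" "dn i j"
  then obtain c c' where "c \<noteq> 0" "c *m outer (ax i) (ax j) = c' *m outer (ax j) (ax i)"
    unfolding up_def dn_def by metis
  then have "(c *m outer (ax i) (ax j)) $ i $ j = (c' *m outer (ax j) (ax i)) $ i $ j" by simp
  with \<open>c \<noteq> 0\<close> \<open>i \<noteq> j\<close> show False by (simp add: axis_nth')
qed

text \<open>Both products of the two matrix units vanish, so the images N and M commute. They are
  nonzero, of trace and square zero, and live on the index sets {i, j} and {i, k}; comparing entries
  of NM and MN leaves each a single off-diagonal entry, on the same side for both.\<close>

lemma same_row_type:
  assumes d: "i \<noteq> j" "i \<noteq> k" "j \<noteq> k" and le: "le i j" "le i k"
  shows "up i j \<and> up i k \<or> dn i j \<and> dn i k"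
proof -
  define N where "N = \<phi> (outer (ax i) (ax j))"
  define M where "M = \<phi> (outer (ax i) (ax k))"
  note n = unit_image[OF le(1) d(1), folded N_def]
  note m = unit_image[OF le(2) d(2), folded M_def]
  have "N ** M = M ** N" unfolding N_def M_def
    by (rule comm) (use le d in \<open>auto simp: incidence_unit outer_mult dotp_simps axis_nth'\<close>)
  note e = matrix_unit_commute_entries[OF d n(2) m(2) this]
  have Nz: "N $ a $ b = 0" if "a \<notin> {i, j} \<or> b \<notin> {i, j}" for a b using n(2) that by blast
  have Mz: "M $ a $ b = 0" if "a \<notin> {i, k} \<or> b \<notin> {i, k}" for a b using m(2) that by blast
  note z = Nz[of i k] Nz[of k i] Nz[of k k] Nz[of j k] Nz[of k j]
    Mz[of i j] Mz[of j i] Mz[of j j] Mz[of j k] Mz[of k j]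
  have e1: "N $ i $ i * M $ i $ k = 0" using e[of i k] z d by simp
  have e2: "N $ j $ i * M $ i $ k = 0" using e[of j k] z d by simp
  have e3: "M $ i $ i * N $ i $ j = 0" using e[of i j] z d by simp
  have e4: "M $ k $ i * N $ i $ j = 0" using e[of k j] z d by simp
  have e5: "N $ j $ i * M $ i $ i = 0" using e[of j i] z d by simp
  have e6: "M $ k $ i * N $ i $ i = 0" using e[of k i] z d by simp
  have N0: False if "N $ i $ i = 0" "N $ i $ j = 0" "N $ j $ i = 0"
  proof -
    have "N $ a $ b = 0" for a b using n(3) that Nz[of a b] by fastforce
    then show False using n(1) by (simp add: vec_eq_iff)
  qed
  have M0: False if "M $ i $ i = 0" "M $ i $ k = 0" "M $ k $ i = 0"
  proof -
    have "M $ a $ b = 0" for a b using m(3) that Mz[of a b] by fastforce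
    then show False using m(1) by (simp add: vec_eq_iff)
  qed
  \<comment> \<open>A nonzero \<open>N $ i $ i\<close> would kill both off-diagonal entries of M,
    and then the square-zero relation its diagonal, against M being nonzero.\<close>
  have Nii: "N $ i $ i = 0"
  proof (rule ccontr)
    assume "N $ i $ i \<noteq> 0"
    then have "M $ i $ k = 0" "M $ k $ i = 0" using e1 e6 by auto
    moreover from this have "M $ i $ i = 0" using m(4) by simp
    ultimately show False using M0 by blast
  qed
  have Mii: "M $ i $ i = 0"
  proof (rule ccontr)
    assume "M $ i $ i \<noteq> 0"
    then have "N $ i $ j = 0" "N $ j $ i = 0" using e3 e5 by auto
    then show False using N0 Nii by blast
  qed
  have Njj: "N $ j $ j = 0" and Mkk: "M $ k $ k = 0" using n(3) m(3) Nii Mii by auto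
  have p: "N $ i $ j * N $ j $ i = 0" "M $ i $ k * M $ k $ i = 0" using n(4) m(4) Nii Mii by auto
  show ?thesis
  proof (cases "N $ j $ i = 0")
    case True
    then have b: "N $ i $ j \<noteq> 0" using N0 Nii by blast
    then have c: "M $ k $ i = 0" using e4 by simp
    then have b': "M $ i $ k \<noteq> 0" using M0 Mii by blast
    have "N = N $ i $ j *m outer (ax i) (ax j)"
      by (rule matrix_with_single_entry) (use d True Nii Njj Nz in \<open>metis empty_iff insert_iff\<close>)
    moreover have "M = M $ i $ k *m outer (ax i) (ax k)"
      by (rule matrix_with_single_entry) (use d c Mii Mkk Mz in \<open>metis empty_iff insert_iff\<close>)
    ultimately have "up i j \<and> up i k" unfolding up_def using b b' N_def M_def by blast
    then show ?thesis ..
  next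
    case False
    then have b: "N $ i $ j = 0" "M $ i $ k = 0" using p e2 by auto
    then have c: "M $ k $ i \<noteq> 0" using M0 Mii by blast
    have "N = N $ j $ i *m outer (ax j) (ax i)"
      by (rule matrix_with_single_entry) (use d b Nii Njj Nz in \<open>metis empty_iff insert_iff\<close>)
    moreover have "M = M $ k $ i *m outer (ax k) (ax i)"
      by (rule matrix_with_single_entry) (use d b Mii Mkk Mz in \<open>metis empty_iff insert_iff\<close>)
    ultimately have "dn i j \<and> dn i k" unfolding dn_def using False c N_def M_def by blast
    then show ?thesis ..
  qed
qed

lemma same_column_type:
  assumes d: "i \<noteq> j" "k \<noteq> j" "i \<noteq> k" and le: "le i j" "le k j"
  shows "up i j \<and> up k j \<or> dn i j \<and> dn k j"
proof -
  interpret D: diagonal_fixing_map "\<lambda>i j. le j i" "\<lambda>X. transpose (\<phi> (transpose X))"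
    by (rule dual_diagonal_fixing)
  have eq: "transpose Y = c *m outer (ax a) (ax b) \<longleftrightarrow> Y = c *m outer (ax b) (ax a)" for Y c a b
    by (metis transpose_mscale transpose_outer transpose_transpose)
  have "D.up a b \<longleftrightarrow> up b a" "D.dn a b \<longleftrightarrow> dn b a" for a b
    by (simp_all add: D.up_def up_def D.dn_def dn_def transpose_outer eq)
  then show ?thesis using D.same_row_type[of j i k] assms by auto
qed

text \<open>With \<open>a\<close> minimal and \<open>z\<close> maximal, every pair is connected to
  (a, z) by moves that keep a row or a column, and such moves preserve the type.\<close>

lemma uniform_type:
  "(\<forall>i j. le i j \<longrightarrow> i \<noteq> j \<longrightarrow> up i j) \<or> (\<forall>i j. le i j \<longrightarrow> i \<noteq> j \<longrightarrow> dn i j)"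
proof -
  interpret D: diagonal_fixing_map "\<lambda>i j. le j i" "\<lambda>X. transpose (\<phi> (transpose X))"
    by (rule dual_diagonal_fixing)
  obtain a where a: "\<And>x. le a x" using minimal_element by blast
  obtain z0 where z0: "\<And>x. le x z0" using D.minimal_element by blast
  \<comment> \<open>If the maximal index found equals \<open>a\<close>, all indices are equivalent
    and any other one is maximal as well.\<close>
  have "\<exists>z. (\<forall>x. le x z) \<and> z \<noteq> a"
  proof (cases "z0 = a")
    case True
    obtain z where "z \<noteq> a" by (rule third[of a a])
    then show ?thesis using True z0 a le_trans by blast
  qed (use z0 in blast)
  then obtain z where z: "\<And>x. le x z" "z \<noteq> a" by blast
  have row: "up i j \<longleftrightarrow> up i k" and row': "up i j \<or> dn i j"
    if "i \<noteq> j" "i \<noteq> k" "j \<noteq> k" "le i j" "le i k" for i j k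
    using same_row_type[OF that] up_dn_exclusive that by blast+
  have col: "up i j \<longleftrightarrow> up k j" and col': "up i j \<or> dn i j"
    if "i \<noteq> j" "k \<noteq> j" "i \<noteq> k" "le i j" "le k j" for i j k
    using same_column_type[OF that] up_dn_exclusive that by blast+
  have link: "up i j \<longleftrightarrow> up a z" if ij: "le i j" "i \<noteq> j" for i j
  proof (cases "i = z")
    case False
    have "up i j \<longleftrightarrow> up i z" using row[of i j z] ij False z by blast
    also have "\<dots> \<longleftrightarrow> up a z" using col[of i z a] False z by metis
    finally show ?thesis .
  next
    case True
    show ?thesis
    proof (cases "j = a")
      case False
      have "up z j \<longleftrightarrow> up a j" using col[of z j a] False ij True a z by metis
      also have "\<dots> \<longleftrightarrow> up a z" using row[of a j z] False ij True a z by metis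
      finally show ?thesis using True by simp
    next
      case ja: True
      \<comment> \<open>For the reversed pair all indices are equivalent, and the chain is (z, a),
        (z, k), (a, k), (a, z).\<close>
      obtain k where k: "k \<noteq> a" "k \<noteq> z" by (rule third)
      have all: "le x y" for x y using ij True ja a z le_trans by metis
      have "up z a \<longleftrightarrow> up z k" using row[of z a k] k z all by metis
      also have "\<dots> \<longleftrightarrow> up a k" using col[of z k a] k z all by metis
      also have "\<dots> \<longleftrightarrow> up a z" using row[of a k z] k z all by metis
      finally show ?thesis using True ja by simp
    qed
  qed
  have updn: "up i j \<or> dn i j" if ij: "le i j" "i \<noteq> j" for i j
  proof -
    obtain k where k: "k \<noteq> i" "k \<noteq> j" by (rule third)
    show ?thesis
    \<comment> \<open>A third index shares the row if \<open>le i k\<close>; otherwise totality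
      gives \<open>le k i\<close>, hence \<open>le k j\<close>, and it shares the column.\<close>
    proof (cases "le i k")
      case True then show ?thesis using row'[of i j k] ij k by metis
    next
      case False
      then have "le k j" using le_total le_trans ij by blast
      then show ?thesis using col'[of i j k] ij k by metis
    qed
  qed
  show ?thesis
  proof (cases "up a z")
    case True then show ?thesis using link by blast
  next
    case False then show ?thesis using link updn by blast
  qed
qed

end

section \<open>Idempotents that differ from a diagonal unit by a multiple of one matrix unit\<close>

locale unit_preserving_map = diagonal_fixing_map le \<phi>
  for le :: "'n::finite \<Rightarrow> 'n \<Rightarrow> bool" and \<phi> :: "complex^'n^'n \<Rightarrow> complex^'n^'n" +
  assumes unit: "le i j \<Longrightarrow> i \<noteq> j \<Longrightarrow>
    \<exists>c. c \<noteq> 0 \<and> \<phi> (outer (axis i 1) (axis j 1)) = c *m outer (axis i 1) (axis j 1)"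
begin

lemma dual_unit_preserving:
  "unit_preserving_map (\<lambda>i j. le j i) (\<lambda>X. transpose (\<phi> (transpose X)))"
proof -
  have "\<exists>c. c \<noteq> 0 \<and> transpose (\<phi> (transpose (outer (ax i) (ax j)))) = c *m outer (ax i) (ax j)"
    if ij: "le j i" "i \<noteq> j" for i j
  proof -
    obtain c where "c \<noteq> 0" "\<phi> (outer (ax j) (ax i)) = c *m outer (ax j) (ax i)"
      using unit[of j i] ij by blast
    then show ?thesis by (auto simp: transpose_outer transpose_mscale)
  qed
  then show ?thesis using dual_diagonal_fixing
    by (simp add: unit_preserving_map_def unit_preserving_map_axioms_def)
qed

text \<open>These are the functions with \<open>\<phi> (E\<^sub>i\<^sub>i + x E\<^sub>i\<^sub>j) = E\<^sub>i\<^sub>i + f\<^sub>i\<^sub>j(x) E\<^sub>i\<^sub>j\<close> and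
  \<open>\<phi> (E\<^sub>j\<^sub>j + x E\<^sub>i\<^sub>j) = E\<^sub>j\<^sub>j + g\<^sub>i\<^sub>j(x) E\<^sub>i\<^sub>j\<close> for \<open>i \<noteq> j\<close>.\<close>

definition f where "f i j x = \<phi> (outer (ax i) (ax i + x *s ax j)) $ i $ j"
definition g where "g i j x = \<phi> (outer (ax j + x *s ax i) (ax j)) $ i $ j"

lemma incidence_row_pair: "le i j \<Longrightarrow> outer (ax i) (ax i + x *s ax j) \<in> incidence le"
  by (rule incidence_row) (auto simp: axis_nth' le_refl split: if_splits)

lemma img_row_pairI:
  assumes "img (ax i) (ax i + x *s ax j) u v" "i \<noteq> j" "u $ j = 0"
  shows "img (ax i) (ax i + x *s ax j) (ax i) (ax i + f i j x *s ax j)"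
proof -
  have u: "u $ k = 0" if "k \<noteq> i" for k
    using img_support(1)[OF assms(1), of k] assms(3) that by (cases "k = j") (auto simp: axis_nth')
  have v: "v $ k = 0" if "k \<noteq> i" "k \<noteq> j" for k
    using img_support(2)[OF assms(1), of k] that by (auto simp: axis_nth')
  have ue: "u = u $ i *s ax i" using u by (auto simp: vec_eq_iff axis_nth')
  have "dotp v (u $ i *s ax i) = 1" using assms(1) ue by (simp add: img_def)
  then have uv: "u $ i * v $ i = 1" by (simp add: dotp_simps mult.commute)
  have o: "outer u v = outer (ax i) (ax i + (u $ i * v $ j) *s ax j)"
    using u v uv assms(2) by (auto simp: vec_eq_iff axis_nth')
  then have "f i j x = u $ i * v $ j"
    using assms(1,2) by (simp add: f_def img_def axis_nth')
  with o assms show ?thesis by (intro img_cong[OF assms(1)]) (auto simp: dotp_simps axis_nth')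
qed

lemma img_column_pairI:
  assumes "img (ax j + x *s ax i) (ax j) u v" "i \<noteq> j" "v $ i = 0"
  shows "img (ax j + x *s ax i) (ax j) (ax j + g i j x *s ax i) (ax j)"
proof -
  have v: "v $ k = 0" if "k \<noteq> j" for k
    using img_support(2)[OF assms(1), of k] assms(3) that by (cases "k = i") (auto simp: axis_nth')
  have u: "u $ k = 0" if "k \<noteq> i" "k \<noteq> j" for k
    using img_support(1)[OF assms(1), of k] that by (auto simp: axis_nth')
  have ve: "v = v $ j *s ax j" using v by (auto simp: vec_eq_iff axis_nth')
  have "dotp (v $ j *s ax j) u = 1" using assms(1) ve by (simp add: img_def)
  then have uv: "u $ j * v $ j = 1" by (simp add: dotp_simps mult.commute)
  have o: "outer u v = outer (ax j + (u $ i * v $ j) *s ax i) (ax j)"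
    using u v uv assms(2) by (auto simp: vec_eq_iff axis_nth')
  then have "g i j x = u $ i * v $ j"
    using assms(1,2) by (simp add: g_def img_def axis_nth')
  with o assms show ?thesis by (intro img_cong[OF assms(1)]) (auto simp: dotp_simps axis_nth')
qed

text \<open>Both products of \<open>E_kj\<close> with \<open>E_ii + x E_ij\<close> vanish. As
  \<open>v $ k = 0\<close>, commutation of the images reduces to \<open>u $ j = 0\<close>, which
  fixes the shape.\<close>

lemma row_pair_aux:
  assumes ij: "le i j" "i \<noteq> j" and k: "k \<noteq> i" "k \<noteq> j" "le k j"
  shows "img (ax i) (ax i + x *s ax j) (ax i) (ax i + f i j x *s ax j)"
proof -
  obtain u v where uv: "img (ax i) (ax i + x *s ax j) u v"
    using img_ex[OF incidence_row_pair[OF ij(1)]] ij by (auto simp: dotp_simps axis_nth')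
  obtain c where c: "c \<noteq> 0" "\<phi> (outer (ax k) (ax j)) = c *m outer (ax k) (ax j)"
    using unit[OF k(3,2)] by blast
  have "\<phi> (outer (ax i) (ax i + x *s ax j)) ** \<phi> (outer (ax k) (ax j)) =
      \<phi> (outer (ax k) (ax j)) ** \<phi> (outer (ax i) (ax i + x *s ax j))"
    using ij k by (intro comm incidence_row_pair incidence_unit) (auto simp: outer_mult dotp_simps axis_nth')
  then have "outer u v ** (c *m outer (ax k) (ax j)) = (c *m outer (ax k) (ax j)) ** outer u v"
    using uv c by (simp add: img_def)
  moreover have "v $ k = 0" using img_support(2)[OF uv, of k] k by (simp add: axis_nth')
  ultimately have "(c * u $ j) *m outer (ax k) v = 0"
    by (simp add: mscale_mult_left mscale_mult_right outer_mult dotp_simps)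
  moreover have "v \<noteq> 0" using uv by (auto simp: img_def)
  ultimately have "u $ j = 0" using c by (simp add: mscale_eq_0_iff outer_eq_0_iff)
  with uv ij show ?thesis by (intro img_row_pairI)
qed

text \<open>The idempotents \<open>E_ii + x E_ij\<close> and \<open>E_jj - x E_ij\<close> are
  orthogonal. One of the two relations for the images fixes the shape of the second image, the other
  compares the coefficients.\<close>

lemma column_pair_if_row_pair:
  assumes ij: "le i j" "i \<noteq> j"
    and row: "img (ax i) (ax i + x *s ax j) (ax i) (ax i + f i j x *s ax j)"
  shows "img (ax j + (- x) *s ax i) (ax j) (ax j + g i j (- x) *s ax i) (ax j)"
    and "g i j (- x) = - f i j x"
proof -
  have "outer (ax j + (- x) *s ax i) (ax j) \<in> incidence le"
    by (rule incidence_column) (use ij in \<open>auto simp: axis_nth' le_refl split: if_splits\<close>)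
  then obtain u v where uv: "img (ax j + (- x) *s ax i) (ax j) u v"
    using img_ex[of "ax j + (- x) *s ax i" "ax j"] ij by (auto simp: dotp_simps axis_nth')
  have "v $ i = 0"
    using img_orthogonal(2)[OF row uv] ij by (simp add: dotp_simps axis_nth')
  with uv ij show c: "img (ax j + (- x) *s ax i) (ax j) (ax j + g i j (- x) *s ax i) (ax j)"
    by (intro img_column_pairI)
  show "g i j (- x) = - f i j x"
    using img_orthogonal(1)[OF row c] ij by (simp add: dotp_simps axis_nth' eq_neg_iff_add_eq_0 add.commute)
qed

end

text \<open>Dictionary for passing between rows and columns: duality exchanges \<open>f\<close> with
  \<open>g\<close>, the two indices, and the two factors of an idempotent.\<close>

lemma (in unit_preserving_map) dual_f_g:
  fixes le2 \<phi>2
  defines "le2 \<equiv> \<lambda>i j. le j i" and "\<phi>2 \<equiv> \<lambda>X. transpose (\<phi> (transpose X))"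
  shows "unit_preserving_map.f \<phi>2 i j x = g j i x" "unit_preserving_map.g \<phi>2 i j x = f j i x"
    "incidence_map.img le2 \<phi>2 u v u' v' \<longleftrightarrow> img v u v' u'"
proof -
  interpret D: unit_preserving_map le2 \<phi>2
    unfolding le2_def \<phi>2_def by (rule dual_unit_preserving)
  show "D.f i j x = g j i x" "D.g i j x = f j i x"
    unfolding D.f_def D.g_def f_def g_def by (simp_all add: \<phi>2_def transpose_outer)
  have "transpose Y = outer u' v' \<longleftrightarrow> Y = outer v' u'" for Y
    by (metis transpose_outer transpose_transpose)
  moreover have "outer u v \<in> incidence le2 \<longleftrightarrow> outer v u \<in> incidence le"
    by (auto simp: le2_def incidence_def)
  ultimately show "D.img u v u' v' \<longleftrightarrow> img v u v' u'"
    unfolding D.img_def img_def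
    by (simp only: \<phi>2_def transpose_outer dotp_commute[of v u] dotp_commute[of v' u'])
qed

context unit_preserving_map
begin

lemma row_pair:
  assumes ij: "le i j" "i \<noteq> j"
  shows "img (ax i) (ax i + x *s ax j) (ax i) (ax i + f i j x *s ax j)"
proof -
  interpret D: unit_preserving_map "\<lambda>i j. le j i" "\<lambda>X. transpose (\<phi> (transpose X))"
    by (rule dual_unit_preserving)
  obtain k where k: "k \<noteq> i" "k \<noteq> j" by (rule third)
  show ?thesis
  proof (cases "le k j")
    case True with ij k show ?thesis by (intro row_pair_aux)
  next
    case False
    then have ik: "le i k" using ij le_total le_trans by blast
    \<comment> \<open>In the reversed preorder \<open>le i k\<close> is the hypothesis of
      \<open>row_pair_aux\<close>; this settles the column idempotent, and orthogonality, again read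
      dually, leads back to the row.\<close>
    have "D.img (ax j) (ax j + (- x) *s ax i) (ax j) (ax j + D.f j i (- x) *s ax i)"
      using D.row_pair_aux[where i = j and j = i and k = k and x = "- x"] ij k ik by fast
    from D.column_pair_if_row_pair(1)[OF _ _ this] ij show ?thesis
      by (simp add: dual_f_g)
  qed
qed

lemma column_pair:
  assumes "le i j" "i \<noteq> j"
  shows "img (ax j + x *s ax i) (ax j) (ax j + g i j x *s ax i) (ax j)"
  using column_pair_if_row_pair(1)[OF assms row_pair[OF assms, of "- x"]] by simp

lemma g_eq: "le i j \<Longrightarrow> i \<noteq> j \<Longrightarrow> g i j x = - f i j (- x)"
  using column_pair_if_row_pair(2)[OF _ _ row_pair, of i j "- x"] by simp

end

section \<open>Functional equation, linearity and normalization of the coefficients\<close>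

context unit_preserving_map
begin

lemma f_zero: "k \<noteq> i \<Longrightarrow> f i k 0 = 0"
  using img_axis[of i] by (simp add: f_def img_def axis_nth')

text \<open>The idempotent is orthogonal to each \<open>E_kk - r_k E_ik\<close> with
  \<open>r_k\<close> nonzero, whose image is known. The two orthogonality relations yield
  \<open>u $ k = 0\<close> and the ratio of \<open>v $ k\<close> to \<open>v $ i\<close>; if
  \<open>r_k = 0\<close>, \<open>img_support\<close> does this.\<close>

lemma img_row:
  assumes r: "r $ i = 1" "\<And>k. r $ k \<noteq> 0 \<Longrightarrow> le i k"
  shows "img (ax i) r (ax i) (\<chi> k. if k = i then 1 else f i k (r $ k))"
proof -
  obtain u v where uv: "img (ax i) r u v" by (rule img_row_ex[OF r])
  have uk: "u $ k = 0" and vk: "v $ k = f i k (r $ k) * v $ i" if "k \<noteq> i" for k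
  proof -
    have "u $ k = 0 \<and> v $ k = f i k (r $ k) * v $ i"
    proof (cases "r $ k = 0")
      case True
      then show ?thesis using img_support[OF uv, of k] that by (auto simp: axis_nth' f_zero)
    next
      case False
      then have le: "le i k" using r by blast
      have c: "img (ax k + (- (r $ k)) *s ax i) (ax k) (ax k + (- f i k (r $ k)) *s ax i) (ax k)"
        using column_pair[OF le, of "- (r $ k)"] g_eq[OF le, of "- (r $ k)"] that by simp
      from img_orthogonal[OF uv c] r(1) that show ?thesis by (simp add: dotp_simps axis_nth')
    qed
    then show "u $ k = 0" "v $ k = f i k (r $ k) * v $ i" by blast+
  qed
  have "u = u $ i *s ax i" using uk by (auto simp: vec_eq_iff axis_nth')
  then have "dotp v (u $ i *s ax i) = 1" using uv by (simp add: img_def)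
  then have 1: "u $ i * v $ i = 1" by (simp add: dotp_simps)
  have "outer u v $ a $ b = outer (ax i) (\<chi> k. if k = i then 1 else f i k (r $ k)) $ a $ b" for a b
    using uk[of a] vk[of b] 1 by (auto simp: axis_nth' mult.left_commute)
  then have "outer u v = outer (ax i) (\<chi> k. if k = i then 1 else f i k (r $ k))"
    by (simp add: vec_eq_iff)
  then show ?thesis by (rule img_cong[OF uv]) (simp add: dotp_simps)
qed

lemma img_column:
  assumes c: "c $ j = 1" "\<And>k. c $ k \<noteq> 0 \<Longrightarrow> le k j"
  shows "img c (ax j) (\<chi> k. if k = j then 1 else g k j (c $ k)) (ax j)"
proof -
  interpret D: unit_preserving_map "\<lambda>i j. le j i" "\<lambda>X. transpose (\<phi> (transpose X))"
    by (rule dual_unit_preserving)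
  show ?thesis using D.img_row[of c j] c by (simp add: dual_f_g cong: if_cong)
qed

text \<open>Compare the image of \<open>E\<^sub>i\<^sub>i + x E\<^sub>i\<^sub>k + (s + x t) E\<^sub>i\<^sub>j\<close> with that of the orthogonal idempotent
  \<open>E\<^sub>j\<^sub>j - t E\<^sub>k\<^sub>j - s E\<^sub>i\<^sub>j\<close>.\<close>

lemma f_functional_equation:
  assumes d: "i \<noteq> k" "k \<noteq> j" "i \<noteq> j" and le: "le i k" "le k j"
  shows "f i j (s + x * t) = f i j s + f i k x * f k j t"
proof -
  have ij: "le i j" using le le_trans by blast
  define r where "r = ax i + x *s ax k + (s + x * t) *s ax j"
  define c where "c = ax j + (- t) *s ax k + (- s) *s ax i"
  have "r $ i = 1" using d by (simp add: r_def axis_nth')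
  moreover have "le i l" if "r $ l \<noteq> 0" for l
    using that le ij le_refl by (auto simp: r_def axis_nth' split: if_splits)
  ultimately have "img (ax i) r (ax i) (\<chi> k. if k = i then 1 else f i k (r $ k))"
    by (rule img_row)
  moreover have "(\<chi> k. if k = i then 1 else f i k (r $ k)) =
      ax i + f i k x *s ax k + f i j (s + x * t) *s ax j"
    using d by (auto simp: vec_eq_iff r_def axis_nth' f_zero)
  ultimately have R: "img (ax i) r (ax i) (ax i + f i k x *s ax k + f i j (s + x * t) *s ax j)"
    by simp
  have g0: "g l j 0 = 0" if "l \<noteq> j" for l
    using img_axis[of j] that by (simp add: g_def img_def axis_nth')
  have "c $ j = 1" using d by (simp add: c_def axis_nth')
  moreover have "le l j" if "c $ l \<noteq> 0" for l
    using that le ij le_refl by (auto simp: c_def axis_nth' split: if_splits)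
  ultimately have "img c (ax j) (\<chi> k. if k = j then 1 else g k j (c $ k)) (ax j)"
    by (rule img_column)
  moreover have "(\<chi> k. if k = j then 1 else g k j (c $ k)) =
      ax j + (- f k j t) *s ax k + (- f i j s) *s ax i"
    using d le ij by (auto simp: vec_eq_iff c_def axis_nth' g0 g_eq)
  ultimately have C: "img c (ax j) (ax j + (- f k j t) *s ax k + (- f i j s) *s ax i) (ax j)"
    by simp
  have "dotp r c = 0" "dotp (ax j) (ax i) = 0"
    using d by (simp_all add: r_def c_def dotp_simps axis_nth' algebra_simps)
  from img_orthogonal(1)[OF R C this] d show ?thesis
    by (simp add: dotp_simps axis_nth' algebra_simps eq_neg_iff_add_eq_0)
qed

text \<open>The limit does not depend on the null sequence \<open>c\<close>, so different choices of
  \<open>c\<close> can be compared.\<close>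

lemma f_limit:
  assumes ij: "le i j" "i \<noteq> j" and c: "c \<longlonglongrightarrow> 0" "\<And>m. c m \<noteq> 0"
  shows "(\<lambda>m. c m * f i j (x / c m)) \<longlonglongrightarrow> \<phi> (x *m outer (ax i) (ax j)) $ i $ j"
proof -
  define X where "X = (\<lambda>m. c m *m outer (ax i) (ax i + (x / c m) *s ax j))"
  have "X = (\<lambda>m. c m *m outer (ax i) (ax i) + x *m outer (ax i) (ax j))"
    using c(2) by (simp add: fun_eq_iff X_def outer_add_right outer_scale_right mscale_add)
  moreover have "(\<lambda>m. c m *m outer (ax i) (ax i) + x *m outer (ax i) (ax j)) \<longlonglongrightarrow>
      0 *m outer (ax i) (ax i) + x *m outer (ax i) (ax j)"
    by (intro tendsto_intros c)
  ultimately have "X \<longlonglongrightarrow> x *m outer (ax i) (ax j)" by simp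
  moreover have "X m \<in> incidence le" for m
    unfolding X_def by (intro incidence_mscale incidence_row_pair ij)
  ultimately have "(\<lambda>m. \<phi> (X m)) \<longlonglongrightarrow> \<phi> (x *m outer (ax i) (ax j))" by (intro phi_tendsto)
  then have "(\<lambda>m. \<phi> (X m) $ i $ j) \<longlonglongrightarrow> \<phi> (x *m outer (ax i) (ax j)) $ i $ j"
    by (rule tendsto_matrix_nth)
  moreover have "\<phi> (X m) $ i $ j = c m * f i j (x / c m)" for m
    using img_scale[OF row_pair[OF ij, of "x / c m"], of "c m"] ij by (simp add: X_def axis_nth')
  ultimately show ?thesis by simp
qed

text \<open>Additivity follows from the functional equation with x = 1. With continuity it would
  give only real linearity; complex homogeneity comes from evaluating the limit of
  \<open>f_limit\<close> along the two null sequences 1/(m+1) and x/(m+1).\<close>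

lemma f_linear_outer:
  assumes d: "i \<noteq> k" "k \<noteq> j" "i \<noteq> j" and le: "le i k" "le k j"
  shows "f i j x = x * f i j 1"
proof (cases "x = 0")
  case True then show ?thesis using f_zero d by simp
next
  case False
  have ij: "le i j" using le le_trans by blast
  have add: "f i j (s + t) = f i j s + f i j t" for s t
    using f_functional_equation[OF d le, of s 1 t] f_functional_equation[OF d le, of 0 1 t] d
    by (simp add: f_zero)
  have nat: "f i j (of_nat m * t) = of_nat m * f i j t" for m t
  proof (induction m)
    case 0 show ?case using d f_zero[of j i] by simp
  next
    case (Suc m)
    have "f i j (of_nat (Suc m) * t) = f i j (of_nat m * t + t)" by (simp add: algebra_simps)
    also have "\<dots> = of_nat (Suc m) * f i j t" unfolding add Suc by (simp add: algebra_simps)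
    finally show ?case .
  qed
  define c where "c m = (1 / of_nat (Suc m) :: complex)" for m
  have c0: "c \<longlonglongrightarrow> 0" unfolding c_def
    by (rule LIMSEQ_Suc[of "\<lambda>m. 1 / of_nat m"]) (rule lim_1_over_n)
  have cn: "c m \<noteq> 0" for m by (simp add: c_def del: of_nat_Suc)
  have "c m * f i j (x / c m) = f i j x" for m
    using nat[of "Suc m" x] by (simp add: c_def mult.commute del: of_nat_Suc)
  then have 1: "\<phi> (x *m outer (ax i) (ax j)) $ i $ j = f i j x"
    by (intro LIMSEQ_unique[OF f_limit[OF ij d(3) c0 cn, of x]]) simp
  have "(\<lambda>m. x * c m) \<longlonglongrightarrow> x * 0" by (intro tendsto_intros c0)
  then have xc0: "(\<lambda>m. x * c m) \<longlonglongrightarrow> 0" by simp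
  have "x * c m * f i j (x / (x * c m)) = x * f i j 1" for m
    using nat[of "Suc m" 1] False by (simp add: c_def del: of_nat_Suc)
  then have lim: "(\<lambda>m. x * c m * f i j (x / (x * c m))) \<longlonglongrightarrow> x * f i j 1"
    by (simp only: tendsto_const)
  have "\<phi> (x *m outer (ax i) (ax j)) $ i $ j = x * f i j 1"
    by (rule LIMSEQ_unique[OF f_limit[OF ij d(3) xc0, of x] lim]) (use cn False in simp)
  with 1 show ?thesis by simp
qed

lemma f_nonzero:
  assumes "le i j" "i \<noteq> j" shows "f i j 1 \<noteq> 0"
proof
  assume "f i j 1 = 0"
  then have "\<phi> (outer (ax i) (ax i + 1 *s ax j)) = \<phi> (outer (ax i) (ax i))"
    using row_pair[OF assms, of 1] img_axis[of i] by (simp add: img_def)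
  then have "outer (ax i) (ax i + 1 *s ax j) = outer (ax i) (ax i)"
    using inj incidence_row_pair[OF assms(1), of 1] img_axis[of i] by (simp add: img_def inj_on_def)
  then have "outer (ax i) (ax i + 1 *s ax j) $ i $ j = outer (ax i) (ax i) $ i $ j" by simp
  then show False using assms by (simp add: axis_nth')
qed

lemma f_cocycle:
  assumes "i \<noteq> k" "k \<noteq> j" "i \<noteq> j" "le i k" "le k j"
  shows "f i j 1 = f i k 1 * f k j 1"
  using f_functional_equation[OF assms, of 0 1 1] assms(3) f_zero by simp

text \<open>With s = 0 the equation reads \<open>f i j (x * t) = f i k x * f k j t\<close>. The left
  side is linear by \<open>f_linear_outer\<close>, and a factor at 1 is nonzero and cancels.\<close>

lemma f_linear_inner:
  assumes d: "i \<noteq> k" "k \<noteq> j" "i \<noteq> j" and le: "le i k" "le k j"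
  shows "f i k x = x * f i k 1" "f k j x = x * f k j 1"
proof -
  have "f i k x * f k j 1 = x * (f i k 1 * f k j 1)" "f i k 1 * f k j x = x * (f i k 1 * f k j 1)"
    using f_functional_equation[OF d le, of 0 x 1] f_functional_equation[OF d le, of 0 1 x]
      f_linear_outer[OF d le, of x] f_cocycle[OF d le] d(3) f_zero by auto
  then show "f i k x = x * f i k 1" "f k j x = x * f k j 1"
    using f_nonzero le d by auto
qed

text \<open>A third index lies before i, between i and j, or after j, so the pair is an inner or the
  outer pair of a chain of length three.\<close>

lemma f_linear:
  assumes "le i j" "i \<noteq> j"
  shows "f i j x = x * f i j 1"
proof -
  obtain k where k: "k \<noteq> i" "k \<noteq> j" by (rule third)
  consider "le k i" | "le i k" "le k j" | "le j k"
    using le_total by blast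
  then show ?thesis
  proof cases
    case 1 then show ?thesis using f_linear_inner(2)[of k i j x] assms k by metis
  next
    case 2 then show ?thesis using f_linear_outer[of i k j x] assms k by metis
  next
    case 3 then show ?thesis using f_linear_inner(1)[of i j k x] assms k by metis
  qed
qed

text \<open>The factors form a multiplicative cocycle, which is a coboundary: it is trivialised by the
  entries in the row of a minimal index.\<close>

lemma f_coboundary:
  obtains d where "\<And>i. d $ i \<noteq> 0" "\<And>i j. le i j \<Longrightarrow> i \<noteq> j \<Longrightarrow> d $ i * f i j 1 = d $ j"
proof -
  obtain a where a: "\<And>x. le a x" using minimal_element by blast
  define d :: "complex^'n" where "d = (\<chi> k. if k = a then 1 else f a k 1)"
  have "d $ i \<noteq> 0" for i using f_nonzero a by (auto simp: d_def)
  moreover have "d $ i * f i j 1 = d $ j" if ij: "le i j" "i \<noteq> j" for i j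
  proof -
    consider "i = a" | "i \<noteq> a" "j \<noteq> a" | "i \<noteq> a" "j = a" by blast
    then show ?thesis
    proof cases
      case 1 then show ?thesis using ij by (simp add: d_def)
    next
      case 2 then show ?thesis using f_cocycle[of a i j] ij a by (simp add: d_def)
    next
      \<comment> \<open>Here i is equivalent to \<open>a\<close>, and the claim is that
        \<open>f a i 1\<close> and \<open>f i a 1\<close> are inverse to each other. The cocycle
        identity needs distinct indices, hence the detour through k.\<close>
      case 3
      obtain k where k: "k \<noteq> a" "k \<noteq> i" by (rule third)
      have ik: "le i k" using ij 3 a le_trans by blast
      have "f i k 1 = f i a 1 * f a k 1" using f_cocycle[of i a k] 3 ij k a by metis
      moreover have "f a k 1 = f a i 1 * f i k 1" using f_cocycle[of a i k] 3 k a ik by metis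
      ultimately have "f a i 1 * f i a 1 * f a k 1 = 1 * f a k 1" by (metis mult.assoc mult_1)
      moreover have "f a k 1 \<noteq> 0" using f_nonzero[of a k] a k by metis
      ultimately have "f a i 1 * f i a 1 = 1" by (metis mult_right_cancel)
      then show ?thesis using 3 by (simp add: d_def)
    qed
  qed
  ultimately show thesis using that by blast
qed

end

section \<open>Normalized maps fix all rank-one idempotents\<close>

locale pair_fixing_map = unit_preserving_map le \<phi>
  for le :: "'n::finite \<Rightarrow> 'n \<Rightarrow> bool" and \<phi> :: "complex^'n^'n \<Rightarrow> complex^'n^'n" +
  assumes f_id: "le i j \<Longrightarrow> i \<noteq> j \<Longrightarrow> f i j x = x"

text \<open>Conjugation by \<open>diagm d\<close> multiplies entry (i, j) by
  \<open>d $ i / d $ j\<close>, which cancels the factor \<open>f i j 1\<close> by the choice of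
  \<open>d\<close>.\<close>

lemma (in unit_preserving_map) normalize:
  obtains M M' where "M ** M' = mat 1" "M' ** M = mat 1"
    "pair_fixing_map le (\<lambda>X. M ** \<phi> X ** M')"
proof -
  obtain d where d: "\<And>i. d $ i \<noteq> 0" "\<And>i j. le i j \<Longrightarrow> i \<noteq> j \<Longrightarrow> d $ i * f i j 1 = d $ j"
    using f_coboundary by blast
  define M where "M = diagm d"
  define M' where "M' = diagm (\<chi> i. 1 / d $ i)"
  have MM': "M ** M' = mat 1" "M' ** M = mat 1"
    using d(1) by (simp_all add: M_def M'_def diagm_mult flip: diagm_one)
  have nth: "(M ** X ** M') $ i $ j = d $ i * X $ i $ j / d $ j" for X i j
    by (simp add: M_def M'_def mult_diagm_nth diagm_mult_nth)
  interpret N: incidence_map le "\<lambda>X. M ** \<phi> X ** M'" by (rule post_similarity[OF MM'])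
  interpret N: diagonal_fixing_map le "\<lambda>X. M ** \<phi> X ** M'"
    by unfold_locales (use d(1) in \<open>auto simp: vec_eq_iff nth diag\<close>)
  interpret N: unit_preserving_map le "\<lambda>X. M ** \<phi> X ** M'"
  proof
    fix i j assume "le i j" "i \<noteq> j"
    then obtain c where c: "c \<noteq> 0" "\<phi> (outer (ax i) (ax j)) = c *m outer (ax i) (ax j)"
      using unit by blast
    have "M ** \<phi> (outer (ax i) (ax j)) ** M' = (d $ i * c / d $ j) *m outer (ax i) (ax j)"
      by (auto simp: vec_eq_iff nth c axis_nth')
    moreover have "d $ i * c / d $ j \<noteq> 0" using c d(1) by simp
    ultimately show "\<exists>c. c \<noteq> 0 \<and> M ** \<phi> (outer (ax i) (ax j)) ** M' = c *m outer (ax i) (ax j)"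
      by blast
  qed
  have "pair_fixing_map le (\<lambda>X. M ** \<phi> X ** M')"
  proof
    fix i j x assume ij: "le i j" "i \<noteq> j"
    have "N.f i j x = d $ i * f i j x / d $ j" by (simp add: N.f_def f_def nth)
    also have "\<dots> = x" using d[of i] d(1)[of j] d(2)[OF ij] f_linear[OF ij, of x] by (simp add: mult.left_commute)
    finally show "N.f i j x = x" .
  qed
  with MM' that show thesis by blast
qed

context pair_fixing_map
begin

lemma dual_pair_fixing:
  "pair_fixing_map (\<lambda>i j. le j i) (\<lambda>X. transpose (\<phi> (transpose X)))"
proof -
  interpret D: unit_preserving_map "\<lambda>i j. le j i" "\<lambda>X. transpose (\<phi> (transpose X))"
    by (rule dual_unit_preserving)
  show ?thesis
    by unfold_locales (auto simp: dual_f_g g_eq f_id)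
qed

lemma row_fixed:
  assumes "r $ i = 1" "\<And>k. r $ k \<noteq> 0 \<Longrightarrow> le i k"
  shows "img (ax i) r (ax i) r"
proof -
  have "(if k = i then 1 else f i k (r $ k)) = r $ k" for k
    using assms f_id[of i k] f_zero[of k i] by (cases "r $ k = 0") auto
  then show ?thesis using img_row[OF assms] by simp
qed

lemma column_fixed:
  assumes "c $ j = 1" "\<And>k. c $ k \<noteq> 0 \<Longrightarrow> le k j"
  shows "img c (ax j) c (ax j)"
proof -
  interpret D: pair_fixing_map "\<lambda>i j. le j i" "\<lambda>X. transpose (\<phi> (transpose X))"
    by (rule dual_pair_fixing)
  show ?thesis using D.row_fixed[of c j] assms by (simp add: dual_f_g)
qed

lemma img_nonzero_entry: "img u v u' v' \<Longrightarrow> \<exists>i. v $ i * u $ i \<noteq> 0"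
  unfolding img_def dotp_def
  by (metis (no_types, lifting) sum.not_neutral_contains_not_neutral zero_neq_one)

text \<open>As p is minimal, every row r with \<open>r $ p = 1\<close> gives an idempotent in the
  algebra, and it is fixed. If r annihilates u, then \<open>v $ p = 0\<close> makes it orthogonal to
  \<open>outer u v\<close>, so r annihilates \<open>u'\<close>; there are enough such r to force
  proportionality.\<close>

lemma left_factor_if_zero_at_minimal:
  assumes uv: "img u v u' v'" and p: "\<And>x. le p x" "v $ p = 0"
  shows "\<exists>c. u' = c *s u"
proof -
  obtain i where i: "v $ i * u $ i \<noteq> 0" using img_nonzero_entry[OF uv] by blast
  have ip: "i \<noteq> p" using i p by auto
  have key: "u' $ p + s * u' $ k = ((u $ p + s * u $ k) / u $ i) * u' $ i" if "k \<noteq> p" for k s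
  proof -
    \<comment> \<open>The coefficient at i makes r annihilate u; i and k differ from p, so
      \<open>r $ p\<close> stays 1.\<close>
    define r where "r = ax p + s *s ax k - ((u $ p + s * u $ k) / u $ i) *s ax i"
    have "r $ p = 1" using that ip by (simp add: r_def axis_nth')
    then have R: "img (ax p) r (ax p) r" using p(1) by (intro row_fixed) auto
    have "dotp r u = 0" using i by (simp add: r_def dotp_simps)
    then have "dotp r u' = 0"
      using img_orthogonal(2)[OF uv R] p(2) by (simp add: dotp_simps)
    then show ?thesis by (simp add: r_def dotp_simps)
  qed
  have "u' $ p = (u $ p / u $ i) * u' $ i" using key[OF ip, of 0] by simp
  moreover have "u' $ k = (u $ k / u $ i) * u' $ i" if "k \<noteq> p" for k
    using key[OF that, of 1] key[OF that, of 0] by (simp add: add_divide_distrib distrib_right)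
  ultimately have "u' $ k = (u $ k / u $ i) * u' $ i" for k by metis
  then have "u' = (u' $ i / u $ i) *s u"
    unfolding vec_eq_iff vector_smult_component by (metis times_divide_eq_left mult.commute)
  then show ?thesis by blast
qed

lemma right_factor_if_zero_at_maximal:
  assumes "img u v u' v'" "\<And>x. le x z" "u $ z = 0"
  shows "\<exists>c. v' = c *s v"
proof -
  interpret D: pair_fixing_map "\<lambda>i j. le j i" "\<lambda>X. transpose (\<phi> (transpose X))"
    by (rule dual_pair_fixing)
  show ?thesis using D.left_factor_if_zero_at_minimal[of v u v' u' z] assms by (simp add: dual_f_g)
qed

text \<open>If all indices are equivalent, a third one will do; otherwise no maximal index is
  minimal.\<close>

lemma maximal_avoiding:
  assumes "\<And>x. le a x" "\<And>x. le b x"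
  obtains z where "\<And>x. le x z" "z \<noteq> a" "z \<noteq> b"
proof (cases "\<forall>x y. le x y")
  case True
  obtain z where "z \<noteq> a" "z \<noteq> b" by (rule third)
  with True that show thesis by blast
next
  case False
  interpret D: diagonal_fixing_map "\<lambda>i j. le j i" "\<lambda>X. transpose (\<phi> (transpose X))"
    by (rule dual_diagonal_fixing)
  obtain z where z: "\<And>x. le x z" using D.minimal_element by blast
  have "z \<noteq> a" "z \<noteq> b" using False z assms le_trans by metis+
  with z that show thesis by blast
qed

text \<open>In the remaining case v has no zero at a minimal index, so u is supported on minimal
  indices. The fixed rows are then not orthogonal to \<open>outer u v\<close> in general, and
  auxiliary idempotents \<open>outer w y\<close> replace them; their right factor is known from
  \<open>right_factor_if_zero_at_maximal\<close>.\<close>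

lemma left_factor:
  assumes uv: "img u v u' v'"
  shows "\<exists>c. u' = c *s u"
proof (cases "\<exists>p. (\<forall>x. le p x) \<and> v $ p = 0")
  case True then show ?thesis using left_factor_if_zero_at_minimal[OF uv] by blast
next
  case False
  define min where "min p \<longleftrightarrow> (\<forall>x. le p x)" for p
  have vmin: "v $ p \<noteq> 0" if "min p" for p using False that by (auto simp: min_def)
  obtain b0 where b0: "min b0" using minimal_element by (auto simp: min_def)
  have umin: "min q" if "u $ q \<noteq> 0" for q
  proof -
    have "le q b0" using uv that vmin[OF b0] by (auto simp: img_def outer_in_incidence)
    then show ?thesis using b0 le_trans by (auto simp: min_def)
  qed
  have zero: "u' $ l = 0" if l: "\<not> min l" for l
  proof -
    \<comment> \<open>The column c annihilates v, and l is not in the support of u, so the fixed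
      idempotent \<open>outer c (ax l)\<close> is orthogonal to \<open>outer u v\<close>.\<close>
    define c where "c = ax l - (v $ l / v $ b0) *s ax b0"
    have "l \<noteq> b0" using l b0 by blast
    then have "c $ l = 1" by (simp add: c_def axis_nth')
    moreover have "le k l" if "c $ k \<noteq> 0" for k
      using that b0 le_refl by (auto simp: c_def axis_nth' min_def split: if_splits)
    ultimately have C: "img c (ax l) c (ax l)" by (rule column_fixed)
    have "dotp v c = 0" using vmin[OF b0] by (simp add: c_def dotp_simps)
    moreover have "dotp (ax l) u = 0" using umin l by (auto simp: dotp_simps)
    ultimately have "dotp (ax l) u' = 0" by (rule img_orthogonal(2)[OF uv C])
    then show ?thesis by (simp add: dotp_simps)
  qed
  have ort: "dotp y u' = 0" if y: "dotp y u = 0" "y $ b \<noteq> 0" "min b" for y b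
  proof -
    \<comment> \<open>Otherwise y and v are proportional on the support of u, and
      \<open>dotp y u = 0\<close> contradicts \<open>dotp v u = 1\<close>.\<close>
    have "\<exists>a. min a \<and> v $ b * y $ a \<noteq> v $ a * y $ b"
    proof (rule ccontr)
      assume "\<not> ?thesis"
      then have "u $ a * (v $ b * y $ a) = u $ a * (v $ a * y $ b)" for a
        using umin by (cases "u $ a = 0") auto
      then have eq: "v $ b * (y $ a * u $ a) = y $ b * (v $ a * u $ a)" for a
        by (metis mult.assoc mult.commute)
      have "v $ b * dotp y u = y $ b * dotp v u"
        unfolding dotp_def sum_distrib_left eq ..
      with y uv show False by (simp add: img_def)
    qed
    then obtain a where a: "min a" "v $ b * y $ a \<noteq> v $ a * y $ b" by blast
    \<comment> \<open>The combination of \<open>ax a\<close> and \<open>ax b\<close> annihilated by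
      v, scaled so that \<open>dotp y w = 1\<close>; the denominator is nonzero by the choice of
      \<open>a\<close>.\<close>
    define w where "w = (1 / (v $ b * y $ a - v $ a * y $ b)) *s (v $ b *s ax a - v $ a *s ax b)"
    have yw: "dotp y w = 1" using a by (simp add: w_def dotp_simps flip: diff_divide_distrib)
    have vw: "dotp v w = 0" by (simp add: w_def dotp_simps)
    have "outer w y \<in> incidence le"
      using a y(3) by (auto simp: outer_in_incidence w_def axis_nth' min_def split: if_splits)
    then obtain w' y' where wy: "img w y w' y'" using img_ex yw by blast
    \<comment> \<open>Since w lives on {a, b}, it vanishes at such a maximal z.\<close>
    obtain z where z: "\<And>x. le x z" "z \<noteq> a" "z \<noteq> b"
      using maximal_avoiding[of a b] a y(3) by (auto simp: min_def)
    have "w $ z = 0" using z by (simp add: w_def axis_nth')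
    then obtain c where c: "y' = c *s y" using right_factor_if_zero_at_maximal[OF wy z(1)] by blast
    have "c \<noteq> 0" using wy c by (auto simp: img_def)
    moreover have "dotp y' u' = 0" using img_orthogonal(2)[OF uv wy vw y(1)] .
    ultimately show ?thesis using c by (simp add: dotp_simps)
  qed
  obtain i where i: "u $ i \<noteq> 0" using img_nonzero_entry[OF uv] by auto
  have "u' $ k = u' $ i / u $ i * u $ k" for k
  proof (cases "min k \<and> k \<noteq> i")
    case True
    have "dotp (u $ i *s ax k - u $ k *s ax i) u' = 0"
      by (rule ort[of _ k]) (use True i in \<open>auto simp: dotp_simps axis_nth'\<close>)
    then show ?thesis using i by (simp add: dotp_simps field_simps)
  next
    case False
    then show ?thesis using zero[of k] umin[of k] i by auto
  qed
  then have "u' = (u' $ i / u $ i) *s u"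
    unfolding vec_eq_iff vector_smult_component by (metis times_divide_eq_left mult.commute)
  then show ?thesis by blast
qed

lemma right_factor:
  assumes "img u v u' v'"
  shows "\<exists>c. v' = c *s v"
proof -
  interpret D: pair_fixing_map "\<lambda>i j. le j i" "\<lambda>X. transpose (\<phi> (transpose X))"
    by (rule dual_pair_fixing)
  show ?thesis using D.left_factor[of v u v' u'] assms by (simp add: dual_f_g)
qed

lemma rank_one_idempotent_fixed:
  assumes "outer u v \<in> incidence le" "dotp v u = 1"
  shows "\<phi> (outer u v) = outer u v"
proof -
  obtain u' v' where uv: "img u v u' v'" using img_ex[OF assms] by blast
  obtain a b where ab: "u' = a *s u" "v' = b *s v" using left_factor[OF uv] right_factor[OF uv] by blast
  have "dotp v' u' = 1" using uv by (simp add: img_def)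
  then have "a * b = 1" using assms(2) by (simp add: ab dotp_simps mult.commute)
  then show ?thesis using uv by (simp add: img_def ab outer_scale_left outer_scale_right mult.commute)
qed

text \<open>By \<open>image_of_diagonal_algebra\<close> the map is linear on this algebra, and the
  algebra is spanned by rank-one idempotents, which are fixed.\<close>

lemma diagonal_algebra_fixed:
  fixes S S' :: "complex^'n^'n"
  assumes S: "S ** S' = mat 1" "S' ** S = mat 1" and SA: "\<And>d. S ** diagm d ** S' \<in> incidence le"
  shows "\<phi> (S ** diagm d ** S') = S ** diagm d ** S'"
proof -
  obtain T T' :: "complex^'n^'n" where T: "T ** T' = mat 1" "T' ** T = mat 1"
    "\<And>d. \<phi> (S ** diagm d ** S') = T ** diagm d ** T'"
    using image_of_diagonal_algebra[OF S SA] by blast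
  have expand: "R ** diagm d ** R' = (\<Sum>p\<in>UNIV. d $ p *m (R ** diagm (ax p) ** R'))"
    for R R' :: "complex^'n^'n"
    by (subst diagm_eq_sum)
      (simp add: matrix_mult_sum_left matrix_mult_sum_right mscale_mult_left mscale_mult_right)
  have "T ** diagm (ax p) ** T' = S ** diagm (ax p) ** S'" for p
  proof -
    have o: "S ** diagm (ax p) ** S' = outer (S *v ax p) (ax p v* S')"
      by (simp add: diagm_axis sim_outer)
    have "dotp (ax p v* S') (S *v ax p) = (S' ** S) $ p $ p"
      by (simp add: matrix_axis vector_matrix_mult_def dotp_def matrix_mult_nth axis_nth'
        mult_delta_left mult_delta_right)
    then have "dotp (ax p v* S') (S *v ax p) = 1" by (simp add: S(2) mat_def)
    then show ?thesis
      using rank_one_idempotent_fixed[of "S *v ax p" "ax p v* S'"] SA[of "ax p"] T(3)[of "ax p"] o by simp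
  qed
  then have "T ** diagm d ** T' = S ** diagm d ** S'"
    unfolding expand[of T T'] expand[of S S'] by simp
  then show ?thesis by (simp add: T(3))
qed

end

text \<open>The whole conjugated diagonal algebra has to lie in the incidence algebra, as
  \<open>diagonal_algebra_fixed\<close> demands; S itself may lie outside.\<close>

definition diagonalizable_in :: "('n \<Rightarrow> 'n \<Rightarrow> bool) \<Rightarrow> (complex^'n^'n) set"
  where "diagonalizable_in le = {S ** diagm d ** S' | (S :: complex^'n^'n) (S' :: complex^'n^'n) d.
    S ** S' = mat 1 \<and> S' ** S = mat 1 \<and> (\<forall>e. S ** diagm e ** S' \<in> incidence le)}"

lemma (in pair_fixing_map) closure_fixed:
  assumes "X \<in> closure (diagonalizable_in le)"
  shows "\<phi> X = X"
proof -
  obtain Y where Y: "\<And>m. Y m \<in> diagonalizable_in le" "Y \<longlonglongrightarrow> X"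
    using assms closure_sequential by blast
  have "\<phi> (Y m) = Y m \<and> Y m \<in> incidence le" for m
    using Y(1)[of m] diagonal_algebra_fixed by (auto simp: diagonalizable_in_def)
  then have "(\<lambda>m. \<phi> (Y m)) = Y" "(\<lambda>m. \<phi> (Y m)) \<longlonglongrightarrow> \<phi> X"
    using phi_tendsto[OF _ Y(2)] by auto
  then show ?thesis using Y(2) LIMSEQ_unique by metis
qed

lemma inverse_mult:
  fixes B :: "complex^'n^'n"
  assumes "B ** B' = mat 1" "C ** C' = mat 1"
  shows "(B ** C) ** (C' ** B') = mat 1"
  by (metis assms matrix_mul_assoc matrix_mul_rid)

theorem incidence_map_standard_form:
  assumes "incidence_map le \<phi>" and dense: "incidence le \<subseteq> closure (diagonalizable_in le)"
  shows "\<exists>T T'. T ** T' = mat 1 \<and> T' ** T = mat 1 \<and>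
    ((\<forall>X\<in>incidence le. \<phi> X = T ** X ** T') \<or> (\<forall>X\<in>incidence le. \<phi> X = T ** transpose X ** T'))"
proof -
  interpret incidence_map le \<phi> by fact
  have std: "\<exists>T T'. T ** T' = mat 1 \<and> T' ** T = mat 1 \<and> (\<forall>X\<in>incidence le. \<psi> X = T ** X ** T')"
    if "unit_preserving_map le \<psi>" for \<psi>
  proof -
    interpret P: unit_preserving_map le \<psi> by fact
    obtain M M' where M: "M ** M' = mat 1" "M' ** M = mat 1"
      "pair_fixing_map le (\<lambda>X. M ** \<psi> X ** M')" by (rule P.normalize)
    have "\<psi> X = M' ** X ** M" if "X \<in> incidence le" for X
      using pair_fixing_map.closure_fixed[OF M(3), of X] dense that
      by (metis sim_inverse[OF M(2)] subsetD)
    with M show ?thesis by blast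
  qed
  obtain T T' where T: "T ** T' = mat 1" "T' ** T = mat 1" "\<And>d. \<phi> (diagm d) = T ** diagm d ** T'"
    using image_of_diagonal_algebra[of "mat 1" "mat 1"] incidence_diagm by auto
  define \<psi> where "\<psi> X = T' ** \<phi> X ** T" for X
  have unnormalize: "\<phi> X = T ** \<psi> X ** T'" for X by (simp add: \<psi>_def sim_inverse[OF T(1)])
  have "incidence_map le \<psi>" unfolding \<psi>_def by (rule post_similarity[OF T(2,1)])
  then interpret D: diagonal_fixing_map le \<psi>
    by (simp add: diagonal_fixing_map_def diagonal_fixing_map_axioms_def \<psi>_def T(3) sim_inverse[OF T(2)])
  from D.uniform_type show ?thesis
  proof
    assume "\<forall>i j. le i j \<longrightarrow> i \<noteq> j \<longrightarrow> D.up i j"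
    then have "unit_preserving_map le \<psi>" by unfold_locales (auto simp: D.up_def)
    from std[OF this] obtain R R' where R: "R ** R' = mat 1" "R' ** R = mat 1"
      "\<And>X. X \<in> incidence le \<Longrightarrow> \<psi> X = R ** X ** R'" by blast
    have "\<forall>X\<in>incidence le. \<phi> X = (T ** R) ** X ** (R' ** T')"
      by (simp add: unnormalize R(3) matrix_mul_assoc)
    then show ?thesis
      using inverse_mult[OF T(1) R(1)] inverse_mult[OF R(2) T(2)] by blast
  next
    assume dn: "\<forall>i j. le i j \<longrightarrow> i \<noteq> j \<longrightarrow> D.dn i j"
    interpret E: diagonal_fixing_map le "\<lambda>X. transpose (\<psi> X)"
      by (rule D.post_transpose_diagonal_fixing)
    have "unit_preserving_map le (\<lambda>X. transpose (\<psi> X))"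
      by unfold_locales (use dn in \<open>force simp: D.dn_def transpose_mscale transpose_outer\<close>)
    from std[OF this] obtain R R' where R: "R ** R' = mat 1" "R' ** R = mat 1"
      "\<And>X. X \<in> incidence le \<Longrightarrow> transpose (\<psi> X) = R ** X ** R'" by blast
    have R2: "transpose R' ** transpose R = mat 1" "transpose R ** transpose R' = mat 1"
      by (metis R(1,2) matrix_transpose_mul transpose_mat)+
    have "\<psi> X = transpose R' ** transpose X ** transpose R" if "X \<in> incidence le" for X
      by (metis R(3)[OF that] matrix_mul_assoc matrix_transpose_mul transpose_transpose)
    then have "\<forall>X\<in>incidence le. \<phi> X = (T ** transpose R') ** transpose X ** (transpose R ** T')"
      by (simp add: unnormalize matrix_mul_assoc)
    then show ?thesis
      using inverse_mult[OF T(1) R2(1)] inverse_mult[OF R2(2) T(2)] by blast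
  qed
qed

section \<open>Density of diagonalizable matrices\<close>

text \<open>This is the vector p(Z) x.\<close>

definition poly_vec :: "complex^'n^'n \<Rightarrow> complex poly \<Rightarrow> complex^'n \<Rightarrow> complex^'n"
  where "poly_vec Z p x = (\<Sum>i\<le>degree p. coeff p i *s (((*v) Z) ^^ i) x)"

lemma poly_vec_bound:
  assumes "degree p \<le> N"
  shows "poly_vec Z p x = (\<Sum>i\<le>N. coeff p i *s (((*v) Z) ^^ i) x)"
  unfolding poly_vec_def
  by (rule sum.mono_neutral_left) (use assms in \<open>auto simp: coeff_eq_0\<close>)

lemma poly_vec_linear_factor:
  "poly_vec Z ([:- a, 1:] * q) x = Z *v poly_vec Z q x - a *s poly_vec Z q x"
proof -
  let ?z = "\<lambda>i. (((*v) Z) ^^ i) x"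
  define N where "N = degree q"
  have eq: "[:- a, 1:] * q = pCons 0 q - smult a q" by simp
  have "degree ([:- a, 1:] * q) \<le> Suc N"
    using degree_mult_le[of "[:- a, 1:]" q] by (simp add: N_def)
  then have "poly_vec Z ([:- a, 1:] * q) x
      = (\<Sum>i\<le>Suc N. (coeff (pCons 0 q) i - a * coeff q i) *s ?z i)"
    by (subst poly_vec_bound) (simp_all only: eq coeff_diff coeff_smult)
  also have "\<dots> = (\<Sum>i\<le>Suc N. coeff (pCons 0 q) i *s ?z i) - (\<Sum>i\<le>Suc N. a *s (coeff q i *s ?z i))"
    by (simp only: vec.scale_left_diff_distrib sum_subtractf vec.scale_scale)
  also have "(\<Sum>i\<le>Suc N. coeff (pCons 0 q) i *s ?z i) = (\<Sum>i\<le>N. coeff q i *s ?z (Suc i))"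
    by (subst sum.atMost_Suc_shift) simp
  also have "\<dots> = Z *v poly_vec Z q x"
    by (simp add: poly_vec_def N_def vec.sum vec.scale)
  also have "(\<Sum>i\<le>Suc N. a *s (coeff q i *s ?z i)) = a *s poly_vec Z q x"
    by (simp only: poly_vec_bound[of q "Suc N"] N_def vec.scale_sum_right)
  finally show ?thesis .
qed

text \<open>The n + 1 iterates of x under Z are linearly dependent in dimension n.\<close>

lemma annihilating_polynomial:
  fixes Z :: "complex^'n^'n"
  obtains p where "p \<noteq> 0" "poly_vec Z p x = 0"
proof -
  let ?z = "\<lambda>i. (((*v) Z) ^^ i) x"
  define n where "n = CARD('n)"
  have "\<exists>c. (\<exists>i\<le>n. c i \<noteq> 0) \<and> (\<Sum>i\<le>n. c i *s ?z i) = 0"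
  proof (cases "inj_on ?z {..n}")
    case True
    have "vec.dependent (?z ` {..n})"
    proof (rule vec.dependent_biggerset_general)
      have "vec.dim (?z ` {..n}) \<le> n" unfolding n_def
        using vec.dim_subset_UNIV[of "?z ` {..n}"] by (simp add: vec.dimension_def card_cart_basis n_def)
      then show "vec.dim (?z ` {..n}) < card (?z ` {..n})"
        by (simp add: card_image[OF True])
    qed
    then obtain u v where u: "v \<in> ?z ` {..n}" "u v \<noteq> 0" "(\<Sum>v\<in>?z ` {..n}. u v *s v) = 0"
      using vec.dependent_finite[of "?z ` {..n}"] by auto
    then have "(\<Sum>i\<le>n. u (?z i) *s ?z i) = 0" by (simp add: sum.reindex[OF True])
    with u show ?thesis by (intro exI[of _ "\<lambda>i. u (?z i)"]) auto
  next
    case False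
    \<comment> \<open>Dependence is a notion for sets and does not see repeated iterates; a
      repetition gives a relation directly.\<close>
    then obtain i j where ij: "i \<le> n" "j \<le> n" "i \<noteq> j" "?z i = ?z j" by (auto simp: inj_on_def)
    define c :: "nat \<Rightarrow> complex" where "c k = (if k = i then 1 else if k = j then - 1 else 0)" for k
    have "(\<Sum>k\<le>n. c k *s ?z k) = (\<Sum>k\<in>{i, j}. c k *s ?z k)"
      by (rule sum.mono_neutral_right) (use ij in \<open>auto simp: c_def\<close>)
    also have "\<dots> = 0" using ij by (simp add: c_def)
    finally show ?thesis using ij(1) by (intro exI[of _ c]) (auto simp: c_def intro!: exI[of _ i])
  qed
  then obtain c i where c: "i \<le> n" "c i \<noteq> 0" "(\<Sum>i\<le>n. c i *s ?z i) = 0" by blast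
  define p where "p = (\<Sum>i\<le>n. monom (c i) i)"
  have co: "coeff p k = (if k \<le> n then c k else 0)" for k
    by (simp add: p_def coeff_sum if_distrib cong: if_cong)
  have "p \<noteq> 0" using co[of i] c by auto
  moreover have "degree p \<le> n" by (rule degree_le) (simp add: co)
  then have "poly_vec Z p x = 0" using c by (simp add: poly_vec_bound co)
  ultimately show thesis using that by blast
qed

text \<open>Linear factors are split off an annihilating polynomial of x. The first time the
  remaining polynomial no longer kills x, its value at x is an eigenvector; it lies in W by
  invariance.\<close>

lemma invariant_set_eigenvector:
  fixes Z :: "complex^'n^'n"
  assumes W: "\<And>x. x \<in> W \<Longrightarrow> Z *v x \<in> W" "\<And>x y. x \<in> W \<Longrightarrow> y \<in> W \<Longrightarrow> x + y \<in> W"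
      "\<And>c x. x \<in> W \<Longrightarrow> c *s x \<in> W"
    and x: "x \<in> W" "x \<noteq> 0"
  obtains w m where "w \<in> W" "w \<noteq> 0" "Z *v w = m *s w"
proof -
  have pw: "poly_vec Z p x \<in> W" for p
  proof -
    have z: "(((*v) Z) ^^ i) x \<in> W" for i by (induction i) (auto simp: x W)
    have "(\<Sum>i\<in>K. coeff p i *s (((*v) Z) ^^ i) x) \<in> W" if "finite K" for K
      using that by (induction K rule: finite_induct) (use W z x W(3)[of x 0] in auto)
    then show ?thesis by (simp add: poly_vec_def)
  qed
  have "\<exists>w\<in>W. \<exists>m. w \<noteq> 0 \<and> Z *v w = m *s w" if "p \<noteq> 0" "poly_vec Z p x = 0" for p
    using that
  proof (induction "degree p" arbitrary: p rule: less_induct)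
    case less
    have "degree p \<noteq> 0"
    proof
      assume "degree p = 0"
      then obtain c where "p = [:c:]" by (rule degree_eq_zeroE)
      with less.prems x show False by (simp add: poly_vec_def)
    qed
    then obtain a where "poly p a = 0"
      using fundamental_theorem_of_algebra[of p] by (auto simp: constant_degree)
    then obtain q where q: "p = [:- a, 1:] * q" by (metis poly_eq_0_iff_dvd dvdE)
    have q0: "q \<noteq> 0" using less.prems q by auto
    show ?case
    proof (cases "poly_vec Z q x = 0")
      case True
      have "degree p = Suc (degree q)" using q0 unfolding q by (subst degree_mult_eq) auto
      then show ?thesis using less.hyps[of q] True q0 by simp
    next
      case False
      have "Z *v poly_vec Z q x = a *s poly_vec Z q x"
        using less.prems(2) unfolding q poly_vec_linear_factor by simp
      then show ?thesis using False pw by blast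
    qed
  qed
  then show thesis using annihilating_polynomial[of Z x] that by metis
qed

text \<open>Deleting the rows of Y outside B makes the coordinate subspace of B invariant.\<close>

lemma eigenvector_of_compression:
  fixes Y :: "complex^'n^'n"
  assumes "b \<in> B"
  obtains w m where "w \<noteq> 0" "\<And>p. p \<notin> B \<Longrightarrow> w $ p = 0"
    "\<And>p. p \<in> B \<Longrightarrow> (Y *v w) $ p = m * w $ p"
proof -
  define Z :: "complex^'n^'n" where "Z = (\<chi> p q. if p \<in> B then Y $ p $ q else 0)"
  have Z: "(Z *v x) $ p = (if p \<in> B then (Y *v x) $ p else 0)" for x p
    by (simp add: Z_def matrix_vector_mult_def)
  define W where "W = {x::complex^'n. \<forall>p. p \<notin> B \<longrightarrow> x $ p = 0}"
  obtain w m where "w \<in> W" "w \<noteq> 0" "Z *v w = m *s w"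
    by (rule invariant_set_eigenvector[of W Z "axis b 1"])
      (use assms in \<open>auto simp: W_def Z axis_nth'\<close>)
  moreover from this have "(Y *v w) $ p = m * w $ p" if "p \<in> B" for p
    using Z[of w p] that by simp
  ultimately show thesis using that by (auto simp: W_def)
qed

lemma outer_mult_vector: "outer a y *v x = dotp y x *s a"
  by (simp add: vec_eq_iff matrix_vector_mult_def dotp_def sum_distrib_left sum_distrib_right ac_simps)

text \<open>The rank-one inverse formula with k = 1 + \<open>dotp b a\<close>.\<close>

lemma sherman_morrison:
  fixes a b :: "complex^'n"
  assumes "dotp b a = k - 1" "k \<noteq> 0"
  shows "(mat 1 + outer a b) ** (mat 1 - (1 / k) *m outer a b) = mat 1"
proof -
  have "(mat 1 + outer a b) ** (mat 1 - (1 / k) *m outer a b)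
      = mat 1 + (1 - 1 / k - (k - 1) / k) *m outer a b"
    by (simp add: matrix_mult_add_left matrix_mult_diff_right mscale_mult_right outer_mult assms(1))
      (use assms(2) in \<open>simp add: vec_eq_iff field_simps\<close>)
  also have "1 - 1 / k - (k - 1) / k = 0" using assms(2) by (simp add: field_simps)
  finally show ?thesis by simp
qed

text \<open>Otherwise \<open>N\<close> is injective, although it maps the span of the coordinates up
  to k into the span of those strictly before k.\<close>

lemma upper_triangular_diagonal_in_spectrum:
  fixes U :: "complex^'n::{finite,linorder}^'n::{finite,linorder}"
  assumes U: "\<And>p q. q < p \<Longrightarrow> U $ p $ q = 0"
  shows "U $ k $ k \<in> spectrum U"
proof (rule ccontr)
  assume n: "U $ k $ k \<notin> spectrum U"
  define N where "N = U - mat (U $ k $ k)"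
  have N: "N *v x = U *v x - (U $ k $ k) *s x" for x
    by (simp add: N_def vec_eq_iff matrix_vector_mult_def mat_def left_diff_distrib sum_subtractf
        mult_delta_left)
  have injN: "inj_on ((*v) N) K" for K
    using n by (auto simp: inj_on_def spectrum_def N)
      (metis N eq_iff_diff_eq_0 matrix_vector_mult_diff_distrib)
  define V where "V D = {x::(complex,'n) vec. \<forall>i. i \<notin> D \<longrightarrow> x $ i = 0}" for D
  have Nnth: "N $ p $ q = 0" if "p \<ge> k" "q \<le> k" for p q
    using that U[of q p] by (cases "p = q") (auto simp: N_def mat_def)
  have "((*v) N) ` V {..k} \<subseteq> V {..<k}"
  proof
    fix y assume "y \<in> ((*v) N) ` V {..k}"
    then obtain x where x: "x \<in> V {..k}" "y = N *v x" by blast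
    have "N $ p $ q * x $ q = 0" if "p \<ge> k" for p q
      using that Nnth[of p q] x(1) by (cases "q \<le> k") (auto simp: V_def)
    then show "y \<in> V {..<k}"
      by (simp add: V_def x(2) matrix_vector_mult_def sum.neutral del: mult_eq_0_iff)
  qed
  then have "vec.dim (((*v) N) ` V {..k}) \<le> vec.dim (V {..<k})" by (rule vec.dim_subset)
  moreover have "vec.dim (((*v) N) ` V {..k}) = vec.dim (V {..k})"
    by (rule vec.dim_image_eq) (auto intro: injN)
  ultimately have "card {..k} \<le> card {..<k}" by (simp only: V_def dim_substandard_cart)
  moreover have "{..<k} \<subset> {..k}" by auto
  then have "card {..<k} < card {..k}" by (intro psubset_card_mono) auto
  ultimately show False by simp
qed

section \<open>Triangularization and perturbation inside an incidence algebra\<close>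

context total_preorder
begin

lemma incidence_one: "mat 1 \<in> incidence le"
  using le_refl by (auto simp: incidence_def mat_def)

lemma incidence_diff: "X \<in> incidence le \<Longrightarrow> Y \<in> incidence le \<Longrightarrow> X - Y \<in> incidence le"
  unfolding incidence_def mem_Collect_eq by (metis diff_self vector_minus_component)

text \<open>Lagrange interpolation at the distinct entries of \<open>l\<close> writes every matrix
  with the same eigenvectors as a polynomial in the given member, and the algebra is unital.\<close>

lemma diagonal_algebra_of_member:
  fixes V V' :: "complex^'n^'n"
  assumes V: "V ** V' = mat 1" "V' ** V = mat 1" and l: "inj (\<lambda>i. l $ i)"
    and A: "V ** diagm l ** V' \<in> incidence le"
  shows "V ** diagm e ** V' \<in> incidence le"
proof -
  have base: "V ** diagm (\<chi> i. l $ i - c) ** V' \<in> incidence le" for c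
  proof -
    have "diagm (\<chi> i. l $ i - c) = diagm l + (- c) *m mat 1"
      by (auto simp: vec_eq_iff mat_def)
    then have "V ** diagm (\<chi> i. l $ i - c) ** V' = V ** diagm l ** V' + (- c) *m mat 1"
      by (simp add: sim_add sim_mscale V)
    then show ?thesis using incidence_add[OF A incidence_mscale[OF incidence_one, of "- c"]] by simp
  qed
  have prod: "V ** diagm (\<chi> i. \<Prod>q\<in>Q. l $ i - l $ q) ** V' \<in> incidence le" if "finite Q" for Q
    using that
  proof (induction Q rule: finite_induct)
    case empty then show ?case using incidence_one by (simp add: diagm_one V)
  next
    case (insert q Q)
    have "diagm (\<chi> i. \<Prod>q\<in>insert q Q. l $ i - l $ q) =
        diagm (\<chi> i. l $ i - l $ q) ** diagm (\<chi> i. \<Prod>q\<in>Q. l $ i - l $ q)"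
      using insert.hyps by (simp add: diagm_mult)
    then show ?case
      using incidence_mult[OF base insert.IH, of "l $ q"] by (simp add: sim_mult[OF V(2)])
  qed
  have unit: "V ** diagm (axis p 1) ** V' \<in> incidence le" for p
  proof -
    define c where "c = (\<Prod>q\<in>-{p}. l $ p - l $ q)"
    have "c \<noteq> 0" using l by (auto simp: c_def inj_def)
    moreover have "(\<Prod>q\<in>-{p}. l $ i - l $ q) = 0" if "i \<noteq> p" for i
      using that by (intro prod_zero) auto
    ultimately have "diagm (axis p 1) = (1 / c) *m diagm (\<chi> i. \<Prod>q\<in>-{p}. l $ i - l $ q)"
      by (auto simp: vec_eq_iff axis_nth' c_def)
    then show ?thesis
      using incidence_mscale[OF prod[of "- {p}"], of "1 / c"] by (simp add: sim_mscale)
  qed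
  have "V ** diagm e ** V' = (\<Sum>p\<in>UNIV. e $ p *m (V ** diagm (axis p 1) ** V'))"
    by (subst diagm_eq_sum)
      (simp add: matrix_mult_sum_left matrix_mult_sum_right mscale_mult_left mscale_mult_right)
  then show ?thesis using unit by (auto intro!: incidence_sum incidence_mscale)
qed

end

locale linear_total_preorder = total_preorder le
  for le :: "'n::{finite,linorder} \<Rightarrow> 'n \<Rightarrow> bool" +
  assumes le_if_less_eq: "i \<le> j \<Longrightarrow> le i j"
begin

text \<open>The next column is treated with an eigenvector of the part of the matrix that lies in the current
  block and below the finished columns; the base change is a rank-one perturbation of the identity.\<close>

lemma triangularize_columns:
  assumes X: "X \<in> incidence le" and D: "\<And>p q. q \<in> D \<Longrightarrow> p \<le> q \<Longrightarrow> p \<in> D"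
  shows "\<exists>S S'. S ** S' = mat 1 \<and> S' ** S = mat 1 \<and> S \<in> incidence le \<and> S' \<in> incidence le \<and>
    (\<forall>q\<in>D. \<forall>p>q. (S' ** X ** S) $ p $ q = 0)"
  using D
proof (induction "card D" arbitrary: D)
  case 0
  then have "D = {}" by simp
  then show ?case using incidence_one by (intro exI[of _ "mat 1"]) simp
next
  case (Suc n)
  define k where "k = Max D"
  have D0: "finite D" "D \<noteq> {}" using Suc.hyps(2) by auto
  have kD: "k \<in> D" and kmax: "\<And>q. q \<in> D \<Longrightarrow> q \<le> k" using D0 by (auto simp: k_def)
  have Dk: "D - {k} = {q. q < k}" using kmax Suc.prems[OF kD] by (force simp: less_le)
  have "n = card (D - {k})" using Suc.hyps(2) kD by simp
  moreover have "p \<in> D - {k}" if "q \<in> D - {k}" "p \<le> q" for p q using that unfolding Dk by auto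
  ultimately obtain S S' where S: "S ** S' = mat 1" "S' ** S = mat 1"
      "S \<in> incidence le" "S' \<in> incidence le" "\<And>p q. q \<in> D - {k} \<Longrightarrow> p > q \<Longrightarrow> (S' ** X ** S) $ p $ q = 0"
    using Suc.hyps(1)[of "D - {k}"] by metis
  define Y where "Y = S' ** X ** S"
  have YA: "Y \<in> incidence le" unfolding Y_def by (intro incidence_mult S X)
  have Ytri: "Y $ p $ q = 0" if "q < k" "p > q" for p q using S(5)[of q p] that by (auto simp: Y_def Dk)
  define B where "B = {p. k \<le> p \<and> le p k}"
  have kB: "k \<in> B" by (simp add: B_def le_refl)
  obtain w m where w: "w \<noteq> 0" "\<And>p. p \<notin> B \<Longrightarrow> w $ p = 0"
    "\<And>p. p \<in> B \<Longrightarrow> (Y *v w) $ p = m * w $ p"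
    using eigenvector_of_compression[OF kB, of Y] by blast
  have Yw: "(Y *v w) $ p = m * w $ p" if "k \<le> p" for p
  proof (cases "p \<in> B")
    case True then show ?thesis using w by blast
  next
    case False
    \<comment> \<open>If \<open>w $ q\<close> is nonzero, then \<open>le q k\<close>; a nonzero
      \<open>Y $ p $ q\<close> would give \<open>le p k\<close> and put p into B.\<close>
    have "Y $ p $ q * w $ q = 0" for q
      using YA w(2)[of q] False that le_trans[of p q k] by (auto simp: incidence_def B_def)
    then have "(Y *v w) $ p = 0" by (simp add: matrix_vector_mult_def sum.neutral del: mult_eq_0_iff)
    then show ?thesis using w(2)[OF False] by simp
  qed
  \<comment> \<open>\<open>R\<close> below sends \<open>axis k 1\<close> to w because
    \<open>y $ k = 1\<close>, and it is invertible because \<open>dotp y w\<close> is nonzero.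
    Support in B keeps it inside the algebra.\<close>
  obtain y where y: "y $ k = 1" "dotp y w \<noteq> 0" "\<And>p. p \<notin> B \<Longrightarrow> y $ p = 0"
  proof (cases "w $ k = 0")
    case False
    show thesis by (rule that[of "axis k 1"]) (use False kB in \<open>auto simp: dotp_simps axis_nth'\<close>)
  next
    case True
    obtain l where "w $ l \<noteq> 0" using w(1) by (auto simp: vec_eq_iff)
    moreover from this have "l \<in> B" "l \<noteq> k" using w(2) True by auto
    ultimately show thesis
      by (intro that[of "axis k 1 + axis l 1"]) (use kB True in \<open>auto simp: dotp_simps axis_nth'\<close>)
  qed
  define a where "a = w - axis k 1"
  define R where "R = mat 1 + outer a y"
  define R' where "R' = mat 1 - (1 / dotp y w) *m outer a y"
  have aB: "a $ p = 0" if "p \<notin> B" for p using that w(2) kB by (auto simp: a_def axis_nth')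
  have RR': "R ** R' = mat 1" unfolding R_def R'_def
    by (rule sherman_morrison) (use y in \<open>simp_all add: a_def dotp_simps\<close>)
  then have R'R: "R' ** R = mat 1" by (simp add: matrix_left_right_inverse)
  have oA: "outer a y \<in> incidence le"
    unfolding outer_in_incidence
    using aB y(3) le_trans le_if_less_eq unfolding B_def mem_Collect_eq by metis
  have RA: "R \<in> incidence le" "R' \<in> incidence le"
    unfolding R_def R'_def by (intro incidence_add incidence_diff incidence_one incidence_mscale oA)+
  have Rx: "R *v x = x + dotp y x *s a" for x
    by (simp add: R_def matrix_vector_mult_add_rdistrib outer_mult_vector)
  \<comment> \<open>y is supported at indices from k on, so the finished columns are not
    disturbed.\<close>
  have Rfix: "R *v x = x" if "\<And>p. k \<le> p \<Longrightarrow> x $ p = 0" for x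
  proof -
    have "dotp y x = 0" unfolding dotp_def
      using that y(3) by (intro sum.neutral) (auto simp: B_def)
    then show ?thesis by (simp add: Rx)
  qed
  have Rfix': "R' *v x = x" if "\<And>p. k \<le> p \<Longrightarrow> x $ p = 0" for x
    by (metis Rfix[OF that] R'R matrix_vector_mul_assoc matrix_vector_mul_lid)
  have Rk: "R *v axis k 1 = w" using y(1) by (simp add: Rx dotp_simps a_def)
  then have R'w: "R' *v w = axis k 1" by (metis R'R matrix_vector_mul_assoc matrix_vector_mul_lid)
  have tri: "(R' ** Y ** R) $ p $ q = 0" if q: "q \<in> D" and p: "p > q" for p q
  proof -
    have col: "(R' ** Y ** R) $ p $ q = (R' *v (Y *v (R *v axis q 1))) $ p"
    proof -
      have "(R' ** Y ** R) $ p $ q = ((R' ** Y ** R) *v axis q 1) $ p" by (simp add: matrix_axis)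
      then show ?thesis by (simp only: matrix_vector_mul_assoc matrix_mul_assoc)
    qed
    show ?thesis
    proof (cases "q = k")
      case True
      \<comment> \<open>The error of the eigenvector equation vanishes from row k on, hence
        \<open>R'\<close> fixes it.\<close>
      define x where "x = Y *v w - m *s w"
      have "R' *v x = x" by (rule Rfix') (simp add: x_def Yw)
      moreover have "Y *v w = m *s w + x" by (simp add: x_def)
      ultimately have "R' *v (Y *v w) = m *s axis k 1 + x"
        by (simp add: vec.add vec.scale R'w)
      then have "(R' ** Y ** R) $ p $ q = (m *s axis k 1 + x) $ p" using col True Rk by simp
      then show ?thesis using p True Yw[of p] by (simp add: x_def axis_nth')
    next
      case False
      then have qk: "q < k" using q kmax by (simp add: less_le)
      have "R *v axis q 1 = axis q 1" by (rule Rfix) (use qk in \<open>auto simp: axis_nth'\<close>)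
      moreover have "R' *v (Y *v axis q 1) = Y *v axis q 1"
        by (rule Rfix') (use qk Ytri in \<open>auto simp: matrix_axis\<close>)
      ultimately show ?thesis using Ytri[OF qk p] by (simp add: col matrix_axis)
    qed
  qed
  have "R' ** Y ** R = (R' ** S') ** X ** (S ** R)" by (simp add: Y_def matrix_mul_assoc)
  then show ?case
    using tri inverse_mult[OF S(1) RR'] inverse_mult[OF R'R S(2)] incidence_mult[OF S(3) RA(1)]
      incidence_mult[OF RA(2) S(4)] by (intro exI[of _ "S ** R"] exI[of _ "R' ** S'"]) simp
qed

text \<open>After triangularization within the algebra, adding a small multiple of a diagonal matrix
  with distinct entries makes the diagonal entries, which are eigenvalues, distinct.\<close>

lemma dense_diagonalizable: "incidence le \<subseteq> closure (diagonalizable_in le)"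
proof
  fix X assume X: "X \<in> incidence le"
  obtain S S' where S: "S ** S' = mat 1" "S' ** S = mat 1" "S \<in> incidence le" "S' \<in> incidence le"
    and tri: "\<And>p q. q < p \<Longrightarrow> (S' ** X ** S) $ p $ q = 0"
    using triangularize_columns[OF X, of UNIV] by auto
  define U where "U = S' ** X ** S"
  obtain l :: "(complex, 'n) vec" where l: "inj (\<lambda>i. l $ i)" by (rule obtain_distinct_vector)
  define bad where "bad = {t. \<exists>i j. i \<noteq> j \<and> U $ i $ i + t * l $ i = U $ j $ j + t * l $ j}"
  have "bad \<subseteq> (\<Union>i. \<Union>j. {(U $ j $ j - U $ i $ i) / (l $ i - l $ j)})"
  proof
    fix t assume "t \<in> bad"
    then obtain i j where ij: "i \<noteq> j" "U $ i $ i + t * l $ i = U $ j $ j + t * l $ j"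
      by (auto simp: bad_def)
    have "l $ i - l $ j \<noteq> 0" using l ij by (auto simp: inj_def)
    moreover have "t * (l $ i - l $ j) = U $ j $ j - U $ i $ i" using ij(2) by (simp add: algebra_simps)
    ultimately have "t = (U $ j $ j - U $ i $ i) / (l $ i - l $ j)"
      by (simp add: nonzero_eq_divide_eq)
    then show "t \<in> (\<Union>i. \<Union>j. {(U $ j $ j - U $ i $ i) / (l $ i - l $ j)})" by blast
  qed
  then have "finite bad" by (rule finite_subset) auto
  then have "closure (- bad) = UNIV" by (simp add: closure_complement empty_interior_finite)
  \<comment> \<open>Only finitely many t are bad, so 0 is a limit of good ones even if it is bad
    itself.\<close>
  then obtain t where t: "\<And>m. t m \<notin> bad" "t \<longlonglongrightarrow> 0"
    using closure_sequential[of 0 "- bad"] by auto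
  define W where "W m = U + t m *m diagm l" for m
  define Y where "Y m = S ** W m ** S'" for m
  have "Y m \<in> diagonalizable_in le" for m
  proof -
    define d where "d = (\<chi> i. W m $ i $ i)"
    have d: "inj (\<lambda>i. d $ i)"
      using t(1)[of m] by (auto simp: inj_def bad_def d_def W_def)
    have "d $ i \<in> spectrum (W m)" for i
      using upper_triangular_diagonal_in_spectrum[of "W m" i] tri
      by (simp add: d_def W_def U_def)
    then have sp: "d $ i \<in> spectrum (Y m)" for i by (simp add: Y_def spectrum_sim[OF S(1,2)])
    obtain V V' where V: "V ** V' = mat 1" "V' ** V = mat 1" "Y m = V ** diagm d ** V'"
      using distinct_eigenvalues_diagonalizable[OF d sp] by blast
    have "W m \<in> incidence le" unfolding W_def U_def
      by (intro incidence_add incidence_mscale incidence_mult incidence_diagm X S)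
    then have "Y m \<in> incidence le" unfolding Y_def by (intro incidence_mult S)
    then show ?thesis
      using V diagonal_algebra_of_member[OF V(1,2) d] unfolding diagonalizable_in_def by auto
  qed
  moreover have "Y \<longlonglongrightarrow> S ** (U + 0 *m diagm l) ** S'"
    unfolding Y_def W_def by (intro tendsto_intros t)
  then have "Y \<longlonglongrightarrow> X" by (simp add: U_def sim_inverse[OF S(1)])
  ultimately show "X \<in> closure (diagonalizable_in le)" using closure_sequential by blast
qed

end

section \<open>Block upper-triangular algebras\<close>

lemma matrix_inv_eq:
  fixes T :: "complex^'n^'n"
  assumes "T ** T' = mat 1" "T' ** T = mat 1"
  shows "matrix_inv T = T'"
proof -
  have "T ** matrix_inv T = mat 1 \<and> matrix_inv T ** T = mat 1"
    unfolding matrix_inv_def by (rule someI[of _ T']) (use assms in blast)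
  then show ?thesis by (metis assms(2) matrix_mul_assoc matrix_mul_lid matrix_mul_rid)
qed

text \<open>All \<open>E_ii\<close> belong to A, and \<open>E_ii X E_jj\<close> is a multiple of
  \<open>E_ij\<close>; hence A is spanned by the matrix units it contains.\<close>

lemma block_upper_triangular_eq_incidence:
  fixes A :: "(complex^'n::{finite,linorder}^'n::{finite,linorder}) set"
  assumes "block_upper_triangular_subalgebra A"
  defines "le \<equiv> \<lambda>i j. outer (axis i 1) (axis j 1) \<in> A"
  shows "linear_total_preorder le" "A = incidence le"
proof -
  have A: "0 \<in> A" "\<And>X Y. X \<in> A \<Longrightarrow> Y \<in> A \<Longrightarrow> X + Y \<in> A" "\<And>c X. X \<in> A \<Longrightarrow> c *m X \<in> A"
    "\<And>X Y. X \<in> A \<Longrightarrow> Y \<in> A \<Longrightarrow> X ** Y \<in> A" "\<And>X. upper_triangular_mat X \<Longrightarrow> X \<in> A"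
    using assms by (auto simp: block_upper_triangular_subalgebra_def mat_subalgebra_def)
  have upper: "le i j" if "i \<le> j" for i j
    unfolding le_def
    by (rule A(5)) (use that in \<open>auto simp: upper_triangular_mat_def axis_nth'\<close>)
  show "linear_total_preorder le"
  proof
    show "le i i" "i \<le> j \<Longrightarrow> le i j" for i j using upper by auto
    show "le i j \<or> le j i" for i j using upper[of i j] upper[of j i] linear[of i j] by auto
    show "le i k" if "le i j" "le j k" for i j k
      using A(4)[of "outer (axis i 1) (axis j 1)" "outer (axis j 1) (axis k 1)"] that
      by (simp add: le_def outer_mult dotp_simps)
  qed
  have sum: "sum f K \<in> A" if "\<And>k. k \<in> K \<Longrightarrow> f k \<in> A" for f :: "'n \<Rightarrow> _" and K
    using that by (induction K rule: infinite_finite_induct) (auto intro: A)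
  show "A = incidence le"
  proof
    show "A \<subseteq> incidence le"
    proof
      fix X assume X: "X \<in> A"
      have "le i j" if "X $ i $ j \<noteq> 0" for i j
      proof -
        have "(1 / X $ i $ j) *m (outer (axis i 1) (axis i 1) ** X ** outer (axis j 1) (axis j 1)) \<in> A"
          using upper[of i i] upper[of j j] X by (intro A(3,4)) (auto simp: le_def)
        moreover have "outer (axis i 1) (axis i 1) ** X ** outer (axis j 1) (axis j 1)
            = X $ i $ j *m outer (axis i 1) (axis j 1)"
          by (auto simp: vec_eq_iff outer_mult_matrix vector_matrix_mult_def axis_nth'
              mult_delta_left mult_delta_right)
        ultimately show ?thesis using that by (simp add: le_def)
      qed
      then show "X \<in> incidence le" by (simp add: incidence_def)
    qed
    show "incidence le \<subseteq> A"
    proof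
      fix X assume X: "X \<in> incidence le"
      have "X = (\<Sum>i\<in>UNIV. \<Sum>j\<in>UNIV. X $ i $ j *m outer (axis i 1) (axis j 1))"
        by (simp add: vec_eq_iff axis_nth' mult_delta_left mult_delta_right)
      moreover have "X $ i $ j *m outer (axis i 1) (axis j 1) \<in> A" for i j
        using X A(1,3) by (cases "X $ i $ j = 0") (auto simp: incidence_def le_def)
      ultimately show "X \<in> A" by (metis (no_types, lifting) sum)
    qed
  qed
qed

text \<open>Similarity respects products and transposition reverses them; the Jordan product is
  symmetric, so both forms respect it.\<close>

lemma jordan_embedding_similarity:
  fixes T :: "complex^'n^'n"
  assumes T: "T' ** T = mat 1" and "inj_on \<phi> A"
    and closed: "\<And>X Y. X \<in> A \<Longrightarrow> Y \<in> A \<Longrightarrow> X + Y \<in> A \<and> X ** Y \<in> A" "\<And>c X. X \<in> A \<Longrightarrow> c *m X \<in> A"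
    and form: "(\<forall>X\<in>A. \<phi> X = T ** X ** T') \<or> (\<forall>X\<in>A. \<phi> X = T ** transpose X ** T')"
  shows "jordan_embedding_on A \<phi>"
proof -
  have tadd: "transpose (X + Y) = transpose X + transpose Y" for X Y :: "complex^'n^'n"
    by (simp add: vec_eq_iff)
  have "jordan_homomorphism_on A \<phi>"
    unfolding jordan_homomorphism_on_def using form
  proof
    assume "\<forall>X\<in>A. \<phi> X = T ** X ** T'"
    then show "(\<forall>X\<in>A. \<forall>Y\<in>A. \<phi> (X + Y) = \<phi> X + \<phi> Y) \<and> (\<forall>c. \<forall>X\<in>A. \<phi> (c *m X) = c *m \<phi> X) \<and>
      (\<forall>X\<in>A. \<forall>Y\<in>A. \<phi> (jordan_prod X Y) = jordan_prod (\<phi> X) (\<phi> Y))"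
      using closed by (simp add: jordan_prod_def sim_add sim_mscale sim_mult[OF T])
  next
    assume "\<forall>X\<in>A. \<phi> X = T ** transpose X ** T'"
    then show "(\<forall>X\<in>A. \<forall>Y\<in>A. \<phi> (X + Y) = \<phi> X + \<phi> Y) \<and> (\<forall>c. \<forall>X\<in>A. \<phi> (c *m X) = c *m \<phi> X) \<and>
      (\<forall>X\<in>A. \<forall>Y\<in>A. \<phi> (jordan_prod X Y) = jordan_prod (\<phi> X) (\<phi> Y))"
      using closed by (simp add: jordan_prod_def tadd transpose_mscale matrix_transpose_mul
          sim_add sim_mscale sim_mult[OF T] add.commute)
  qed
  with assms show ?thesis by (simp add: jordan_embedding_on_def)
qed

theorem theorem1p4:
  fixes A :: "(complex^'n::{finite,linorder}^'n::{finite,linorder}) set"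
    and \<phi> :: "complex^'n::{finite,linorder}^'n::{finite,linorder} \<Rightarrow> complex^'n::{finite,linorder}^'n::{finite,linorder}"
  assumes "CARD('n) \<ge> 3"
    and "block_upper_triangular_subalgebra A"
    and "continuous_on A \<phi>"
    and "inj_on \<phi> A"
    and "preserves_commutativity_on A \<phi>"
    and "preserves_spectrum_on A \<phi>"
  shows "jordan_embedding_on A \<phi> \<and>
    (\<exists>T. invertible T \<and>
      ((\<forall>X\<in>A. \<phi> X = T ** X ** matrix_inv T) \<or>
       (\<forall>X\<in>A. \<phi> X = T ** transpose X ** matrix_inv T)))"
proof -
  define le where "le i j \<longleftrightarrow> outer (axis i 1) (axis j 1) \<in> A" for i j
  interpret linear_total_preorder le
    using block_upper_triangular_eq_incidence(1)[OF assms(2)] by (simp add: le_def[abs_def])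
  have A: "A = incidence le"
    using block_upper_triangular_eq_incidence(2)[OF assms(2)] by (simp add: le_def[abs_def])
  have "incidence_map le \<phi>"
    by unfold_locales
      (use assms in \<open>auto simp: preserves_commutativity_on_def preserves_spectrum_on_def A[symmetric]\<close>)
  from incidence_map_standard_form[OF this dense_diagonalizable] obtain T T' where
    T: "T ** T' = mat 1" "T' ** T = mat 1" and
    form: "(\<forall>X\<in>A. \<phi> X = T ** X ** T') \<or> (\<forall>X\<in>A. \<phi> X = T ** transpose X ** T')"
    unfolding A by blast
  have "jordan_embedding_on A \<phi>"
    by (rule jordan_embedding_similarity[OF T(2) assms(4) _ _ form])
      (auto simp: A intro: incidence_add incidence_mult incidence_mscale)
  moreover have "invertible T" using T by (auto simp: invertible_def)
  ultimately show ?thesis using form matrix_inv_eq[OF T] by auto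
qed

end
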